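(* Let $f\in\mathcal{C}^\infty_c(\mathbb{R}^d_+)$, let $\widetilde\Phi$ be its extended Stieltjes–Fantappiè transform and let $J_{\widetilde\Phi}$ be the associated jump function (both defined in the context). Then for $d$ even, $$f(x)=\frac{-(-1)^{d/2}}{(2\pi)^d}\int_{\mathbb{S}^{d-1}}\int_{\mathbb{R}}\frac{J_{\widetilde\Phi}(p,-\xi)}{p\cdot x-\xi}\,d\xi\,d\sigma_{d-1}(p),$$ and for $d$ odd, $$f(x)=\frac{(-1)^{(d-1)/2}}{2(2\pi)^{d-1}}\int_{\mathbb{S}^{d-1}}J_{\widetilde\Phi}(p,-p\cdot x)\,d\sigma_{d-1}(p),$$ where $\sigma_{d-1}$ is the surface area measure of the unit sphere $\mathbb{S}^{d-1}$.
   Context: $\mathbb{R}^d_+=(0,\infty)^d$; $\mathcal{C}^\infty_c(\mathbb{R}^d_+)$ is the space of compactly supported smooth functions on $\mathbb{R}^d_+$. The extended Stieltjes–Fantappiè transform of $f$ is $$\widetilde\Phi(p,z)=\int_{\mathbb{R}^d_+}\frac{f(t)}{z+p\cdot t}\,d\lambda_{leb}(t),\qquad (p,z)\in\mathbb{R}^d\times(\mathbb{C}\setminus\{\operatorname{Im}z=0\}),$$ where $\lambda_{leb}$ is Lebesgue measure on $\mathbb{R}^d$. The jump function associated with $\widetilde\Phi$ is $$J_{\widetilde\Phi}(p,\xi)=\frac{1}{\pi}\lim_{\eta\to0^+}\Big(\partial_\xi^{\,d-1}\widetilde\Phi(p,\xi-i\eta)-\partial_\xi^{\,d-1}\widetilde\Phi(p,\xi+i\eta)\Big),\qquad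 (p,\xi)\in\mathbb{R}^{d+1},$$ where $\partial_\xi^{d-1}$ denotes the derivative of order $d-1$ with respect to $\xi$.
   Formalization: The right-hand sides are multiplied by 1/(2i) for d odd and by -1/(2i) for d even, since with J normalised by 1/π the stated formulas give ±2i f(x); the integral over ξ for d even is taken as a Cauchy principal value at ξ = p·x. *)

theory Defs
  imports "HOL-Analysis.Analysis"
begin

definition pos_orthant :: "(real ^ 'n) set" where
  "pos_orthant = {x. \<forall>i. 0 < x $ i}"

text \<open>\<^term>\<open>C_k_on k f S\<close>: all partial derivatives of order at most \<^term>\<open>k\<close> exist and are
  continuous on the open set \<^term>\<open>S\<close>.\<close>

primrec C_k_on :: "nat \<Rightarrow> (real ^ 'n \<Rightarrow> complex) \<Rightarrow> (real ^ 'n) set \<Rightarrow> bool" where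
  "C_k_on 0 f S \<longleftrightarrow> continuous_on S f"
| "C_k_on (Suc k) f S \<longleftrightarrow> (\<forall>x\<in>S. f differentiable (at x)) \<and>
     (\<forall>i. C_k_on k (\<lambda>x. frechet_derivative f (at x) (axis i 1)) S)"

text \<open>Only the values of a test function on the orthant matter; outside it the total function
  \<^term>\<open>f\<close> is unconstrained.\<close>

definition test_function :: "(real ^ 'n \<Rightarrow> complex) \<Rightarrow> bool" where
  "test_function f \<longleftrightarrow> (\<forall>k. C_k_on k f pos_orthant) \<and>
     compact (closure {x \<in> pos_orthant. f x \<noteq> 0}) \<and>
     closure {x \<in> pos_orthant. f x \<noteq> 0} \<subseteq> pos_orthant"

definition SF_transform :: "(real ^ 'n \<Rightarrow> complex) \<Rightarrow> real ^ 'n \<Rightarrow> complex \<Rightarrow> complex" where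
  "SF_transform f p z = (LINT t:pos_orthant|lborel. f t / (z + complex_of_real (p \<bullet> t)))"

definition higher_vector_derivative :: "nat \<Rightarrow> (real \<Rightarrow> complex) \<Rightarrow> real \<Rightarrow> complex" where
  "higher_vector_derivative k g = ((\<lambda>h s. vector_derivative h (at s)) ^^ k) g"

text \<open>The jump is normalised by \<open>1 / pi\<close>, not by \<open>1 / (2 pi i)\<close>.  Since
  \<open>1 / (s - i eta) - 1 / (s + i eta) = 2 i eta / (s^2 + eta^2)\<close>, for \<open>p \<noteq> 0\<close> it equals \<open>2 i\<close> times
  the \<open>(d - 1)\<close>-st derivative in \<open>xi\<close> of \<open>R f (p, - xi)\<close>, where \<open>R f (p, s)\<close> is the integral of
  \<open>f (t)\<close> against \<open>delta (s - p . t)\<close> (for a unit vector \<open>p\<close>, the Radon transform).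
  In particular it is purely imaginary when \<open>f\<close> is real-valued.  With
  \<open>G (p, s)\<close> the \<open>(d - 1)\<close>-st \<open>s\<close>-derivative of \<open>R f (p, s)\<close>, the jump at \<open>(p, - s)\<close> is
  \<open>(-1)^(d - 1) 2 i G (p, s)\<close>; inversion formulas written in terms of this jump therefore differ
  from the classical ones in terms of \<open>G\<close> by the factor \<open>1 / (2 i)\<close> for odd \<open>d\<close> and
  \<open>- 1 / (2 i)\<close> for even \<open>d\<close>.\<close>

definition SF_jump :: "(real ^ 'n \<Rightarrow> complex) \<Rightarrow> real ^ 'n \<Rightarrow> real \<Rightarrow> complex" where
  "SF_jump f p \<xi> = 1 / complex_of_real pi *
     Lim (at_right 0) (\<lambda>\<eta>::real.
       higher_vector_derivative (CARD('n) - 1)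
         (\<lambda>s. SF_transform f p (complex_of_real s - \<i> * complex_of_real \<eta>)) \<xi>
       - higher_vector_derivative (CARD('n) - 1)
         (\<lambda>s. SF_transform f p (complex_of_real s + \<i> * complex_of_real \<eta>)) \<xi>)"

text \<open>Surface area through polar coordinates: \<open>sigma(A)\<close> is \<open>d\<close> times the volume of the cone
  \<open>{r a | 0 < r \<le> 1, a \<in> A}\<close>, i.e. the image under \<open>x / |x|\<close> of \<open>d\<close> times Lebesgue measure on
  the unit ball (the origin, where \<open>sgn 0 = 0\<close>, is a null set).  For \<open>d = 1\<close> this is counting
  measure on \<open>{-1, 1}\<close>.\<close>

definition sphere_measure :: "(real ^ 'n) measure" where
  "sphere_measure =
     distr (density lborel (\<lambda>x. of_nat CARD('n) * indicator (cball 0 1) x)) borel sgn"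

text \<open>Cauchy principal value of an integral over the real line with a singularity at
  \<^term>\<open>a\<close>.\<close>

definition pv_integral :: "real \<Rightarrow> (real \<Rightarrow> complex) \<Rightarrow> complex" where
  "pv_integral a g = Lim (at_right 0) (\<lambda>\<epsilon>. LINT \<xi>:{\<xi>. \<epsilon> < \<bar>\<xi> - a\<bar>}|lborel. g \<xi>)"

end

theory Submission
  imports Defs "HOL-Probability.Probability"
begin

text \<open>Let \<open>g\<close> be \<open>f\<close> extended by zero and \<open>g^\<close> its Fourier transform.  Since
  \<open>(d - 1)! / (a \<mp> i \<eta>)\<^sup>d = (\<plusminus>i)\<^sup>d \<integral> r\<^bsup>d-1\<^esup> exp (- \<eta> r \<mp> i a r) dr\<close> over \<open>r > 0\<close>, Fubini and the limit
  \<open>\<eta> \<rightarrow> 0\<close> give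
  \<open>J (p, - \<xi>) = (-1)\<^bsup>d-1\<^esup> / \<pi> \<sqdot> (i\<^sup>d \<integral> r\<^bsup>d-1\<^esup> g^(r p) exp (i r \<xi>) dr - (-i)\<^sup>d \<integral> r\<^bsup>d-1\<^esup> g^(- r p) exp (- i r \<xi>) dr)\<close>.
  For odd \<open>d\<close> the two terms add up at \<open>\<xi> = p \<sqdot> x\<close>, and integrating over the sphere is Fourier
  inversion in polar coordinates.  For even \<open>d\<close> they have opposite signs, which the principal
  value compensates, as that of \<open>exp (i r s) / s\<close> is \<open>i \<pi> sgn r\<close>.\<close>

subsection \<open>Decay of the Fourier transform\<close>

text \<open>The order d - 1 of the derivative in the jump is what makes the Fourier side fit: it
  turns the Cauchy kernel into a multiple of z^(-d), whose Laplace representation carries the weight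
  r^(d-1), and that weight is exactly the Jacobian of polar coordinates. No Radon transform has to
  be differentiated and no Hilbert transform inverted.

  The limits on the Fourier side are taken by dominated convergence, so \<open>fourier g\<close>
  must be integrable over the space and, against that weight, along every ray. Smoothness enters
  here: the zero extension inherits it because the support is a compact subset of the open orthant,
  and d + 1 derivatives give decay of order d + 1.

  The delicate limit is the principal value, since exp (i r s) / s is not absolutely integrable.
  Truncated to eps < |s| < 1 / eps with eps < 1 its integral is 2 i (Si (r / eps) - Si (r eps)),
  which is bounded uniformly in r and eps; this bound is the majorant.

  After integration over the sphere, positive and negative frequencies contribute the same value (2
  pi)^d f(x), whence the factor 2 in the constants.\<close>

lemma C_k_on_extend_zero:
  fixes f :: "real ^ 'n \<Rightarrow> complex"
  assumes S: "open S" and K: "closed K" "K \<subseteq> S"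
  shows "C_k_on k f S \<Longrightarrow> (\<And>x. x \<in> S - K \<Longrightarrow> f x = 0) \<Longrightarrow>
    C_k_on k (\<lambda>x. if x \<in> S then f x else 0) UNIV"
proof (induction k arbitrary: f)
  case 0
  \<comment> \<open>\<open>S\<close> and \<open>- K\<close> form an open cover, and on
    \<open>- K\<close> the extension is identically 0, so regularity can be checked on each
    piece.\<close>
  have "continuous_on (S \<union> - K) (\<lambda>x. if x \<in> S then f x else 0)"
    using 0 S K by (intro continuous_on_cases_local_open) (auto intro: open_openin_trans openin_open_subtopology simp: openin_open_eq open_Compl)
  moreover have "S \<union> - K = UNIV" using K by auto
  ultimately show ?case by simp
next
  case (Suc k)
  let ?g = "\<lambda>x. if x \<in> S then f x else 0"
  have 1: "(?g has_derivative frechet_derivative f (at x)) (at x)" if "x \<in> S" for x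
  proof -
    have "(f has_derivative frechet_derivative f (at x)) (at x)"
      using Suc.prems(1) that frechet_derivative_works by auto
    then show ?thesis
      by (rule has_derivative_transform_within_open[OF _ S that]) auto
  qed
  have opn: "open (- K)" using K by auto
  have 2: "(?g has_derivative (\<lambda>_. 0)) (at x)" if "x \<notin> K" for x
    by (rule has_derivative_transform_within_open[OF _ opn, of "\<lambda>_. 0"])
       (use that Suc.prems(2) in auto)
  have fd: "frechet_derivative ?g (at x) = (if x \<in> S then frechet_derivative f (at x) else (\<lambda>_. 0))" for x
    using 1[of x] 2[of x] K by (auto dest!: frechet_derivative_at[symmetric])
  \<comment> \<open>On the overlap \<open>S - K\<close> both derivative computations apply. Hence
    the vanishing condition passes to the partial derivatives, which makes the induction hypothesis
    applicable to them.\<close>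
  have z: "frechet_derivative f (at x) = (\<lambda>_. 0)" if "x \<in> S - K" for x
    using 1[of x] 2[of x] that has_derivative_unique by blast
  have "C_k_on k (\<lambda>x. if x \<in> S then frechet_derivative f (at x) (axis i 1) else 0) UNIV" for i
    by (rule Suc.IH) (use Suc.prems(1) z in auto)
  moreover have "?g differentiable (at x)" for x
    using 1[of x] 2[of x] K(2) by (cases "x \<in> S") (auto simp: differentiable_def)
  moreover have "(\<lambda>x. frechet_derivative ?g (at x) (axis i 1)) = (\<lambda>x. if x \<in> S then frechet_derivative f (at x) (axis i 1) else 0)" for i
    unfolding fd by auto
  ultimately show ?case
    by simp
qed

lemma C_k_on_Suc_imp_continuous_on:
  assumes "C_k_on (Suc k) f S"
  shows "continuous_on S f"
  using assms by (auto intro!: continuous_at_imp_continuous_on differentiable_imp_continuous_within)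

lemma integrable_continuous_compact_support:
  fixes g :: "'a::euclidean_space \<Rightarrow> 'b::euclidean_space"
  assumes "continuous_on UNIV g" and "compact K" and "\<And>x. x \<notin> K \<Longrightarrow> g x = 0"
  shows "integrable lborel g"
proof -
  have "integrable lborel (\<lambda>x. indicator K x *\<^sub>R g x)"
    using assms by (intro borel_integrable_compact) (auto intro: continuous_on_subset)
  moreover have "(\<lambda>x. indicator K x *\<^sub>R g x) = g"
    using assms(3) by (auto simp: indicator_def)
  ultimately show ?thesis by simp
qed

text \<open>Passes from the Lebesgue integral to a gauge integral over a compact set; with a box as
  \<open>K\<close> the Leibniz rule for parameter integrals becomes applicable.\<close>

lemma lebesgue_integral_eq_integral_compact_support:
  fixes g :: "'a::euclidean_space \<Rightarrow> 'b::euclidean_space"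
  assumes "continuous_on UNIV g" and "compact K" and "\<And>x. x \<notin> K \<Longrightarrow> g x = 0"
  shows "(LINT x|lborel. g x) = integral K g"
proof -
  have "(LINT x|lborel. g x) = integral UNIV g"
    using integrable_continuous_compact_support[OF assms] by (simp add: integral_lborel)
  also have "\<dots> = integral UNIV (\<lambda>x. if x \<in> K then g x else 0)"
    using assms(3) by (intro integral_cong) auto
  also have "\<dots> = integral K g" by (rule integral_restrict_UNIV)
  finally show ?thesis .
qed

lemma borel_measurable_cis [measurable]: "cis \<in> borel_measurable borel"
  by (intro borel_measurable_continuous_onI continuous_intros)

text \<open>No normalising constant is included, so the whole factor (2 pi)^d appears in the
  inversion formula.\<close>

definition fourier :: "('a::euclidean_space \<Rightarrow> complex) \<Rightarrow> 'a \<Rightarrow> complex" where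
  "fourier g q = (LINT t|lborel. g t * cis (- (q \<bullet> t)))"

text \<open>Instead of integrating by parts, differentiate the translation identity
  \<open>\<integral> g (t + h e) cis (- (q \<bullet> t)) dt = cis (h q\<^sub>j) fourier g q\<close> at \<open>h = 0\<close>.\<close>

lemma fourier_partial_derivative:
  fixes g :: "real ^ 'n \<Rightarrow> complex"
  assumes diff: "\<And>x. g differentiable (at x)"
    and cont: "continuous_on UNIV (\<lambda>x. frechet_derivative g (at x) (axis j 1))"
    and supp: "\<And>x. norm x > R \<Longrightarrow> g x = 0"
  shows "fourier (\<lambda>x. frechet_derivative g (at x) (axis j 1)) q = \<i> * (q $ j) * fourier g q"
proof -
  let ?e = "axis j 1 :: real ^ 'n"
  let ?d = "\<lambda>x. frechet_derivative g (at x) ?e"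
  \<comment> \<open>The margin 1 lets a single box contain the supports of all translates with |h| <
    1, so that the domain of integration does not depend on \<open>h\<close>.\<close>
  obtain a where a: "cball 0 (R + 1) \<subseteq> cbox (-a) (a :: real ^ 'n)"
    by (meson bounded_cball bounded_subset_cbox_symmetric)
  have gc: "continuous_on UNIV g"
    using diff by (auto intro!: continuous_at_imp_continuous_on differentiable_imp_continuous_within)
  have der: "((\<lambda>h. g (t + h *\<^sub>R ?e)) has_vector_derivative ?d (t + h *\<^sub>R ?e)) (at h within U)" for t h U
  proof -
    have g: "(g has_derivative frechet_derivative g (at (t + h *\<^sub>R ?e))) (at (t + h *\<^sub>R ?e))"
      using diff frechet_derivative_works by blast
    have "((\<lambda>h. t + h *\<^sub>R ?e) has_derivative (\<lambda>h. h *\<^sub>R ?e)) (at h within U)"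
      by (auto intro!: derivative_eq_intros)
    from has_derivative_compose[OF this g] show ?thesis
      by (simp add: has_vector_derivative_def linear_scale[OF has_derivative_linear[OF g]])
  qed
  have d0: "?d x = 0" if "norm x > R" for x
  proof -
    have opn: "open {x::real ^ 'n. norm x > R}" by (intro open_Collect_less continuous_intros)
    have "(g has_derivative (\<lambda>_. 0)) (at x)"
      by (rule has_derivative_transform_within_open[OF _ opn, of "\<lambda>_. 0"]) (use that supp in auto)
    then show ?thesis
      by (simp add: frechet_derivative_at[symmetric])
  qed
  define F where "F h t = g (t + h *\<^sub>R ?e) * cis (- (q \<bullet> t))" for h :: real and t
  define F' where "F' h t = ?d (t + h *\<^sub>R ?e) * cis (- (q \<bullet> t))" for h :: real and t
  have cF: "continuous_on UNIV (F h)" for h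
    unfolding F_def by (intro continuous_intros continuous_on_compose2[OF gc]) auto
  have cF': "continuous_on X (\<lambda>(h, t). F' h t)" for X
    unfolding F'_def case_prod_beta by (intro continuous_intros continuous_on_compose2[OF cont]) auto
  have L: "((\<lambda>h. integral (cbox (-a) a) (F h)) has_vector_derivative integral (cbox (-a) a) (F' 0)) (at 0 within {-1<..<1})"
  proof (rule leibniz_rule_vector_derivative)
    show "((\<lambda>h. F h t) has_vector_derivative F' h t) (at h within {-1<..<1})" for h t
      unfolding F_def F'_def by (intro has_vector_derivative_mult_left der)
    show "F h integrable_on cbox (-a) a" for h
      by (rule integrable_continuous) (rule continuous_on_subset[OF cF], simp)
  qed (auto intro: cF')
  have eq: "integral (cbox (-a) a) (F h) = cis (h * q $ j) * fourier g q" if "\<bar>h\<bar> < 1" for h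
  proof -
    have z: "F h t = 0" if t: "t \<notin> cbox (-a) a" for t
    proof -
      have "norm t > R + 1" using subsetD[OF a, of t] t by (metis dist_0_norm mem_cball not_le)
      moreover have "norm t \<le> norm (t + h *\<^sub>R ?e) + norm (h *\<^sub>R ?e)"
        using norm_triangle_ineq4[of "t + h *\<^sub>R ?e" "h *\<^sub>R ?e"] by simp
      ultimately have "norm (t + h *\<^sub>R ?e) > R" using \<open>\<bar>h\<bar> < 1\<close> by simp
      then show ?thesis by (simp add: F_def supp)
    qed
    have "integral (cbox (-a) a) (F h) = (LINT t|lborel. F h t)"
      using lebesgue_integral_eq_integral_compact_support[OF cF compact_cbox z] by simp
    also have "\<dots> = (LINT t|lborel. F h (- (h *\<^sub>R ?e) + t))"
      by (subst lborel_distr_plus[of "- (h *\<^sub>R ?e)", symmetric])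
         (auto simp: integral_distr borel_measurable_continuous_onI cF)
    also have "\<dots> = (LINT t|lborel. cis (h * q $ j) * (g t * cis (- (q \<bullet> t))))"
      by (intro Bochner_Integration.integral_cong)
         (auto simp: F_def cis_mult inner_diff_right inner_axis algebra_simps)
    finally show ?thesis by (simp add: fourier_def)
  qed
  have "((\<lambda>h. cis (h * q $ j) * fourier g q) has_vector_derivative integral (cbox (-a) a) (F' 0)) (at 0 within {-1<..<1})"
    by (rule has_vector_derivative_transform[OF _ _ L]) (auto simp: eq)
  then have "((\<lambda>h. cis (h * q $ j) * fourier g q) has_vector_derivative integral (cbox (-a) a) (F' 0)) (at 0)"
    by (subst (asm) at_within_open) auto
  moreover have "((\<lambda>h. cis (h * q $ j) * fourier g q) has_vector_derivative (\<i> * (q $ j)) * fourier g q) (at 0)"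
    unfolding cis_conv_exp of_real_mult
    by (intro has_vector_derivative_mult_left has_vector_derivative_eq_rhs[OF has_vector_derivative_real_field[of "\<lambda>z. exp (\<i> * (z * (q $ j)))" _ 0]])
       (auto intro!: derivative_eq_intros)
  ultimately have "integral (cbox (-a) a) (F' 0) = \<i> * (q $ j) * fourier g q"
    using vector_derivative_unique_at by blast
  moreover have "fourier ?d q = integral (cbox (-a) a) (F' 0)"
  proof -
    have "norm t > R" if "t \<notin> cbox (-a) a" for t using that a by force
    then show ?thesis
      unfolding fourier_def F'_def
      by (subst lebesgue_integral_eq_integral_compact_support[OF _ compact_cbox[of "-a" a]])
         (auto intro!: continuous_intros cont d0)
  qed
  ultimately show ?thesis by simp
qed

lemma fourier_bound: "norm (fourier g q) \<le> (LINT t|lborel. norm (g t))"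
  unfolding fourier_def
  by (rule order_trans[OF integral_norm_bound]) (simp add: norm_mult)

text \<open>Each derivative in direction \<open>j\<close> multiplies the transform by
  \<open>\<i> * (q $ j)\<close>; after \<open>k\<close> of them the trivial bound by the L^1 norm of
  the last derivative remains.\<close>

lemma fourier_C_k_decay_coordinate:
  fixes g :: "real ^ 'n \<Rightarrow> complex"
  shows "C_k_on k g UNIV \<Longrightarrow> (\<And>x. norm x > R \<Longrightarrow> g x = 0) \<Longrightarrow>
    \<exists>C. \<forall>q. \<bar>q $ j\<bar> ^ k * norm (fourier g q) \<le> C"
proof (induction k arbitrary: g)
  case 0
  show ?case using fourier_bound[of g] by auto
next
  case (Suc k)
  let ?d = "\<lambda>x. frechet_derivative g (at x) (axis j 1)"
  have Ck: "C_k_on k ?d UNIV" using Suc.prems by auto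
  then have cont: "continuous_on UNIV ?d"
    by (cases k) (auto intro: C_k_on_Suc_imp_continuous_on)
  have d0: "?d x = 0" if "norm x > R" for x
  proof -
    have opn: "open {x::real ^ 'n. norm x > R}" by (intro open_Collect_less continuous_intros)
    have "(g has_derivative (\<lambda>_. 0)) (at x)"
      by (rule has_derivative_transform_within_open[OF _ opn, of "\<lambda>_. 0"]) (use that Suc.prems in auto)
    then show ?thesis
      by (simp add: frechet_derivative_at[symmetric])
  qed
  obtain C where "\<bar>q $ j\<bar> ^ k * norm (fourier ?d q) \<le> C" for q
    using Suc.IH[OF Ck d0] by auto
  moreover have "fourier ?d q = \<i> * (q $ j) * fourier g q" for q
    by (rule fourier_partial_derivative[OF _ cont Suc.prems(2)]) (use Suc.prems in auto)
  ultimately show ?case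
    by (auto simp: norm_mult mult_ac)
qed

text \<open>Comparison with the l^1 norm shows that some coordinate of \<open>q\<close> carries at
  least the fraction 1/d of its norm, and the estimate for that coordinate controls the full power
  of the norm. The order 0 bound supplies the summand 1, which keeps the majorant finite at the
  origin.\<close>

lemma fourier_C_k_decay:
  fixes g :: "real ^ 'n \<Rightarrow> complex"
  assumes "C_k_on k g UNIV" "C_k_on 0 g UNIV" "\<And>x. norm x > R \<Longrightarrow> g x = 0"
  shows "\<exists>C\<ge>0. \<forall>q. norm (fourier g q) \<le> C / (1 + norm q ^ k)"
proof -
  have "\<forall>j. \<exists>C. \<forall>q. \<bar>q $ j\<bar> ^ k * norm (fourier g q) \<le> C"
    using fourier_C_k_decay_coordinate[OF assms(1,3)] by blast
  then obtain C where C: "\<And>j q. \<bar>q $ j\<bar> ^ k * norm (fourier g q) \<le> C j" by metis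
  obtain C0 where C0: "norm (fourier g q) \<le> C0" for q
    using fourier_C_k_decay_coordinate[OF assms(2,3)] by auto
  have C0': "C0 \<ge> 0" using C0[of 0] norm_ge_zero order_trans by blast
  have Cj: "C j \<ge> 0" for j using C[of 0 j] by (meson order_trans mult_nonneg_nonneg norm_ge_zero abs_ge_zero zero_le_power)
  define D where "D = C0 + (\<Sum>j\<in>UNIV. C j) * real CARD('n) ^ k"
  have "norm (fourier g q) \<le> D / (1 + norm q ^ k)" for q
  proof -
    have "\<exists>j. norm q \<le> real CARD('n) * \<bar>q $ j\<bar>"
    proof (rule ccontr)
      assume "\<not> ?thesis"
      then have *: "\<bar>q $ j\<bar> < norm q / real CARD('n)" for j
        by (auto simp: not_le field_simps)
      have "norm q \<le> (\<Sum>j\<in>UNIV. \<bar>q $ j\<bar>)" by (rule norm_le_l1_cart)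
      also have "\<dots> < (\<Sum>j\<in>(UNIV::'n set). norm q / real CARD('n))"
        by (intro sum_strict_mono *) auto
      finally show False by simp
    qed
    then obtain j where j: "norm q \<le> real CARD('n) * \<bar>q $ j\<bar>" ..
    have "norm q ^ k * norm (fourier g q) \<le> (real CARD('n) * \<bar>q $ j\<bar>) ^ k * norm (fourier g q)"
      by (intro mult_right_mono power_mono j) auto
    also have "\<dots> = real CARD('n) ^ k * (\<bar>q $ j\<bar> ^ k * norm (fourier g q))"
      by (simp add: power_mult_distrib)
    also have "\<dots> \<le> real CARD('n) ^ k * C j" by (intro mult_left_mono C) auto
    also have "\<dots> \<le> real CARD('n) ^ k * (\<Sum>j\<in>UNIV. C j)"
      by (intro mult_left_mono member_le_sum Cj) auto
    finally have "norm (fourier g q) * (1 + norm q ^ k) \<le> D"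
      using C0[of q] by (simp add: D_def algebra_simps)
    then show ?thesis by (subst pos_le_divide_eq) (auto intro: add_pos_nonneg)
  qed
  moreover have "D \<ge> 0" unfolding D_def using C0' Cj by (auto intro!: add_nonneg_nonneg mult_nonneg_nonneg sum_nonneg)
  ultimately show ?thesis by blast
qed

subsection \<open>Fourier inversion\<close>

text \<open>A one-sided limit can be tested along sequences decreasing to \<open>a\<close>, where
  the sequential convergence theorem applies.\<close>

lemma integral_dominated_convergence_at_right:
  fixes s :: "real \<Rightarrow> 'a \<Rightarrow> 'b::{banach, second_countable_topology}"
  assumes "f \<in> borel_measurable M" "\<And>t. t > a \<Longrightarrow> s t \<in> borel_measurable M" "integrable M w"
    and lim: "\<And>x. x \<in> space M \<Longrightarrow> ((\<lambda>t. s t x) \<longlongrightarrow> f x) (at_right a)"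
    and bound: "\<And>t. t > a \<Longrightarrow> AE x in M. norm (s t x) \<le> w x"
  shows "((\<lambda>t. integral\<^sup>L M (s t)) \<longlongrightarrow> integral\<^sup>L M f) (at_right a)"
proof (rule tendsto_at_right_sequentially[of a "a + 1"])
  fix S :: "nat \<Rightarrow> real"
  assume S: "\<And>n. a < S n" "\<And>n. S n < a + 1" "decseq S" "S \<longlonglongrightarrow> a"
  have "filterlim S (at_right a) sequentially"
    unfolding filterlim_at using S by (auto intro: always_eventually simp: less_imp_neq)
  then show "(\<lambda>n. integral\<^sup>L M (s (S n))) \<longlonglongrightarrow> integral\<^sup>L M f"
    by (intro integral_dominated_convergence[OF assms(1) _ assms(3)])
       (auto intro!: assms S filterlim_compose[OF lim])
qed simp

lemma lborel_integral_affine: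
  fixes h :: "'a::euclidean_space \<Rightarrow> 'b::{banach, second_countable_topology}"
  assumes [measurable]: "h \<in> borel_measurable borel" and "c \<noteq> 0"
  shows "(LINT t|lborel. h t) = \<bar>c\<bar> ^ DIM('a) *\<^sub>R (LINT u|lborel. h (a + c *\<^sub>R u))"
  by (subst lborel_affine[OF \<open>c \<noteq> 0\<close>, of a])
     (simp add: integral_density integral_distr)

section \<open>Gaussian integrals in several variables\<close>

lemma lborel_prod_Basis:
  fixes f :: "'a::euclidean_space \<Rightarrow> real \<Rightarrow> complex"
  assumes "\<And>b. b \<in> Basis \<Longrightarrow> integrable lborel (f b)"
  shows "integrable lborel (\<lambda>x. \<Prod>b\<in>Basis. f b (x \<bullet> b))" (is ?A)
    and "(LINT x|lborel. (\<Prod>b\<in>Basis. f b (x \<bullet> b))) = (\<Prod>b\<in>Basis. LINT s|lborel. f b s)" (is ?B)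
proof -
  interpret product_sigma_finite "\<lambda>_::'a. lborel :: real measure" by standard
  have [measurable]: "f b \<in> borel_measurable borel" if "b \<in> Basis" for b
    using borel_measurable_integrable[OF assms[OF that]] by simp
  have *: "(\<Sum>b\<in>Basis. y b *\<^sub>R b) \<bullet> c = y c" if "c \<in> Basis" for y c
    using that by (simp add: inner_sum_left inner_Basis if_distrib cong: if_cong)
  have 1: "(\<Prod>b\<in>Basis. f b ((\<Sum>b\<in>Basis. y b *\<^sub>R b) \<bullet> b)) = (\<Prod>b\<in>Basis. f b (y b))" for y
    by (intro prod.cong) (auto simp: *)
  show ?A
    by (subst lborel_eq, subst integrable_distr_eq)
       (auto simp: 1 intro!: product_integrable_prod assms)
  show ?B
    by (subst lborel_eq, subst integral_distr)
       (auto simp: 1 intro!: product_integral_prod assms)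
qed

text \<open>Up to the factor sqrt (2 pi), the integral is the characteristic function of the
  standard normal distribution.\<close>

lemma integrable_gaussian_real: "integrable lborel (\<lambda>s. complex_of_real (exp (- s\<^sup>2 / 2)) * cis (s * y))"
  and integral_gaussian_real: "(LINT s|lborel. complex_of_real (exp (- s\<^sup>2 / 2)) * cis (s * y)) =
    complex_of_real (sqrt (2 * pi) * exp (- y\<^sup>2 / 2))"
proof -
  have eq: "complex_of_real (exp (- s\<^sup>2 / 2)) * cis (s * y) = complex_of_real (sqrt (2 * pi)) * (std_normal_density s *\<^sub>R iexp (y * s))" for s
    by (simp add: std_normal_density_def cis_conv_exp mult_ac scaleR_conv_of_real)
  have "integrable lborel (\<lambda>s. std_normal_density s *\<^sub>R iexp (y * s))"
    by (rule Bochner_Integration.integrable_bound[of _ std_normal_density]) (auto simp: norm_mult)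
  then show "integrable lborel (\<lambda>s. complex_of_real (exp (- s\<^sup>2 / 2)) * cis (s * y))"
    unfolding eq by (rule integrable_mult_right)
  have "(LINT s|lborel. std_normal_density s *\<^sub>R iexp (y * s)) = char std_normal_distribution y"
    unfolding char_def by (subst integral_density) auto
  then show "(LINT s|lborel. complex_of_real (exp (- s\<^sup>2 / 2)) * cis (s * y)) =
    complex_of_real (sqrt (2 * pi) * exp (- y\<^sup>2 / 2))"
    unfolding eq integral_mult_right_zero by (simp add: char_std_normal_distribution)
qed

lemma integrable_gaussian: "integrable lborel (\<lambda>q::'a::euclidean_space. complex_of_real (exp (- (norm q)\<^sup>2 / 2)) * cis (q \<bullet> y))" (is ?A)
  and integral_gaussian: "(LINT q::'a::euclidean_space|lborel. complex_of_real (exp (- (norm q)\<^sup>2 / 2)) * cis (q \<bullet> y)) =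
    complex_of_real (sqrt (2 * pi) ^ DIM('a) * exp (- (norm y)\<^sup>2 / 2))" (is ?B)
proof -
  have nn: "(norm q)\<^sup>2 = (\<Sum>b\<in>Basis. (q \<bullet> b)\<^sup>2)" for q :: 'a
    unfolding power2_norm_eq_inner by (subst euclidean_inner) (simp add: power2_eq_square)
  have n: "exp (- (norm q)\<^sup>2 / 2) = (\<Prod>b\<in>Basis. exp (- (q \<bullet> b)\<^sup>2 / 2))" for q :: 'a
    unfolding nn by (simp add: exp_sum[symmetric] sum_negf sum_divide_distrib)
  have c: "cis (q \<bullet> y) = (\<Prod>b\<in>Basis. cis ((q \<bullet> b) * (y \<bullet> b)))" for q :: 'a
    unfolding cis_conv_exp euclidean_inner[of q y] by (simp add: exp_sum sum_distrib_left)
  have eq: "complex_of_real (exp (- (norm q)\<^sup>2 / 2)) * cis (q \<bullet> y) =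
     (\<Prod>b\<in>Basis. complex_of_real (exp (- (q \<bullet> b)\<^sup>2 / 2)) * cis ((q \<bullet> b) * (y \<bullet> b)))" for q :: 'a
    unfolding n c by (simp add: prod.distrib)
  show ?A unfolding eq
    by (rule lborel_prod_Basis) (rule integrable_gaussian_real)
  show ?B unfolding eq n[of y]
    by (subst lborel_prod_Basis(2)[OF integrable_gaussian_real])
       (simp only: integral_gaussian_real of_real_mult prod.distrib of_real_prod of_real_power prod_constant)
qed

lemma integrable_gaussian_exp: "integrable lborel (\<lambda>q::'a::euclidean_space. exp (- (norm q)\<^sup>2 / 2))"
  using integrable_norm[OF integrable_gaussian[of 0]] by (simp add: norm_mult)

lemma integrable_lborel_affine:
  fixes h :: "'a::euclidean_space \<Rightarrow> 'b::{banach, second_countable_topology}"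
  assumes "integrable lborel h" and "c \<noteq> 0"
  shows "integrable lborel (\<lambda>u. h (a + c *\<^sub>R u))"
proof -
  have [measurable]: "h \<in> borel_measurable borel"
    using borel_measurable_integrable[OF assms(1)] by simp
  have "integrable (density (distr lborel borel (\<lambda>x. a + c *\<^sub>R x)) (\<lambda>_. ennreal (\<bar>c\<bar> ^ DIM('a)))) h"
    using assms by (subst (asm) lborel_affine[OF \<open>c \<noteq> 0\<close>, of a])
  then have "integrable lborel (\<lambda>u. \<bar>c\<bar> ^ DIM('a) *\<^sub>R h (a + c *\<^sub>R u))"
    by (simp add: integrable_density integrable_distr_eq)
  then have "integrable lborel (\<lambda>u. inverse (\<bar>c\<bar> ^ DIM('a)) *\<^sub>R \<bar>c\<bar> ^ DIM('a) *\<^sub>R h (a + c *\<^sub>R u))"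
    by (rule integrable_scaleR_right)
  then show ?thesis
    using \<open>c \<noteq> 0\<close> by simp
qed

text \<open>Justifies the Fubini interchanges with oscillating kernels below: the oscillating factor
  has modulus 1, and a product of two integrable functions dominates what is left.\<close>

lemma integrable_pair_mult_bound:
  fixes H :: "'a \<times> 'b \<Rightarrow> complex"
  assumes "sigma_finite_measure M" "sigma_finite_measure N"
    and "integrable M u" "integrable N v" "H \<in> borel_measurable (M \<Otimes>\<^sub>M N)"
    and bound: "\<And>x y. norm (H (x, y)) \<le> norm (u x :: real) * norm (v y :: real)"
  shows "integrable (M \<Otimes>\<^sub>M N) H"
proof -
  interpret pair_sigma_finite M N using assms(1,2) by (simp add: pair_sigma_finite_def)
  have "integrable (M \<Otimes>\<^sub>M N) (\<lambda>(x, y). u x * v y)"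
    using assms by (intro Fubini_integrable) (auto simp: abs_mult)
  then show ?thesis
    by (rule Bochner_Integration.integrable_bound) (use assms in \<open>auto simp: abs_mult\<close>)
qed

text \<open>Without a weight the double integral over \<open>q\<close> and \<open>t\<close> need not
  converge absolutely; the Gaussian makes it so. After the interchange the \<open>q\<close>-integral
  is again a Gaussian, centred at \<open>x\<close> with width \<open>\<epsilon>\<close> and height
  of order \<epsilon>^(-d), and the substitution t = x + \<epsilon> u absorbs that power.\<close>

lemma fourier_gaussian_regularised:
  fixes g :: "'a::euclidean_space \<Rightarrow> complex"
  assumes g: "integrable lborel g" and e: "\<epsilon> > 0"
  shows "(LINT q|lborel. fourier g q * cis (q \<bullet> x) * exp (- (norm (\<epsilon> *\<^sub>R q))\<^sup>2 / 2)) =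
    complex_of_real (sqrt (2 * pi) ^ DIM('a)) * (LINT u|lborel. g (x + \<epsilon> *\<^sub>R u) * exp (- (norm u)\<^sup>2 / 2))"
proof -
  have [measurable]: "g \<in> borel_measurable borel"
    using borel_measurable_integrable[OF g] by simp
  let ?G = "\<lambda>q::'a. exp (- (norm (\<epsilon> *\<^sub>R q))\<^sup>2 / 2)"
  let ?H = "\<lambda>(q, t). g t * cis (- (q \<bullet> t)) * cis (q \<bullet> x) * complex_of_real (?G q)"
  have iG: "integrable lborel ?G"
    using integrable_lborel_affine[OF integrable_gaussian_exp, of \<epsilon> 0] e by simp
  have "integrable lborel (\<lambda>t. norm (g t))" using g by simp
  then have iH: "integrable (lborel \<Otimes>\<^sub>M lborel) ?H"
    by (intro integrable_pair_mult_bound[OF _ _ iG]) 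
       (auto simp: norm_mult mult_ac lborel.sigma_finite_measure_axioms)
  have inner: "(LINT q|lborel. ?H (q, t)) = g t * (\<bar>inverse \<epsilon>\<bar> ^ DIM('a) *\<^sub>R
      complex_of_real (sqrt (2 * pi) ^ DIM('a) * exp (- (norm (inverse \<epsilon> *\<^sub>R (x - t)))\<^sup>2 / 2)))" for t
  proof -
    have "(LINT q|lborel. ?H (q, t)) = (LINT q|lborel. g t * (complex_of_real (?G q) * cis (q \<bullet> (x - t))))"
      by (intro Bochner_Integration.integral_cong) (auto simp: cis_mult inner_diff_right mult_ac)
    also have "\<dots> = g t * (LINT q|lborel. complex_of_real (?G q) * cis (q \<bullet> (x - t)))"
      by simp
    also have "(LINT q|lborel. complex_of_real (?G q) * cis (q \<bullet> (x - t))) =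
      \<bar>inverse \<epsilon>\<bar> ^ DIM('a) *\<^sub>R (LINT q|lborel. complex_of_real (exp (- (norm q)\<^sup>2 / 2)) * cis (q \<bullet> (inverse \<epsilon> *\<^sub>R (x - t))))"
      using e by (subst lborel_integral_affine[of _ "inverse \<epsilon>" 0]) auto
    finally show ?thesis unfolding integral_gaussian .
  qed
  have "(LINT q|lborel. fourier g q * cis (q \<bullet> x) * ?G q) = (LINT q|lborel. LINT t|lborel. ?H (q, t))"
    unfolding fourier_def by (intro Bochner_Integration.integral_cong) auto
  also have "\<dots> = (LINT t|lborel. LINT q|lborel. ?H (q, t))"
    using lborel_pair.Fubini_integral[OF iH] by simp
  also have "\<dots> = complex_of_real (sqrt (2 * pi) ^ DIM('a)) * (LINT u|lborel. g (x + \<epsilon> *\<^sub>R u) * exp (- (norm u)\<^sup>2 / 2))"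
    unfolding inner using e
    by (subst lborel_integral_affine[of _ \<epsilon> x])
       (auto simp: scaleR_conv_of_real mult_ac power_inverse simp flip: integral_mult_right_zero
         intro!: Bochner_Integration.integral_cong)
  finally show ?thesis .
qed

text \<open>Both sides of the regularised identity converge as \<epsilon> tends to 0, with majorants
  |fourier g| on the left and \<open>B\<close> times a Gaussian on the right. The constant is a
  product of two factors sqrt (2 pi)^d: one from the transform of the Gaussian, one from its total
  mass.\<close>

theorem fourier_inversion:
  fixes g :: "'a::euclidean_space \<Rightarrow> complex"
  assumes g: "integrable lborel g" "continuous_on UNIV g" "\<And>t. norm (g t) \<le> B"
    and fg: "integrable lborel (fourier g)"
  shows "(LINT q|lborel. fourier g q * cis (q \<bullet> x)) = complex_of_real ((2 * pi) ^ DIM('a)) * g x"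
proof -
  have [measurable]: "g \<in> borel_measurable borel" "fourier g \<in> borel_measurable borel"
    using borel_measurable_integrable[OF g(1)] borel_measurable_integrable[OF fg] by simp_all
  have 1: "((\<lambda>\<epsilon>. LINT q|lborel. fourier g q * cis (q \<bullet> x) * exp (- (norm (\<epsilon> *\<^sub>R q))\<^sup>2 / 2)) \<longlongrightarrow>
      (LINT q|lborel. fourier g q * cis (q \<bullet> x))) (at_right 0)"
  proof (rule integral_dominated_convergence_at_right)
    show "integrable lborel (\<lambda>q. norm (fourier g q))" using fg by simp
    show "((\<lambda>\<epsilon>. fourier g q * cis (q \<bullet> x) * exp (- (norm (\<epsilon> *\<^sub>R q))\<^sup>2 / 2)) \<longlongrightarrow>
      fourier g q * cis (q \<bullet> x)) (at_right 0)" for q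
      by (rule tendsto_eq_intros refl | simp)+
  qed (auto simp: norm_mult mult_left_le)
  have 2: "((\<lambda>\<epsilon>. LINT u|lborel. g (x + \<epsilon> *\<^sub>R u) * exp (- (norm u)\<^sup>2 / 2)) \<longlongrightarrow>
      (LINT u|lborel. g x * exp (- (norm (u::'a))\<^sup>2 / 2))) (at_right 0)"
  proof (rule integral_dominated_convergence_at_right)
    show "integrable lborel (\<lambda>u::'a. B * exp (- (norm u)\<^sup>2 / 2))"
      by (intro integrable_mult_right integrable_gaussian_exp)
    have "isCont g x" using g(2) by (simp add: continuous_on_eq_continuous_at)
    then have "((\<lambda>\<epsilon>. g (x + \<epsilon> *\<^sub>R u)) \<longlongrightarrow> g x) (at_right 0)" for u
      by (rule isCont_tendsto_compose) (rule tendsto_eq_intros refl | simp)+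
    then show "((\<lambda>\<epsilon>. g (x + \<epsilon> *\<^sub>R u) * exp (- (norm u)\<^sup>2 / 2)) \<longlongrightarrow> g x * exp (- (norm u)\<^sup>2 / 2)) (at_right 0)" for u
      by (intro tendsto_mult tendsto_const)
  qed (auto simp: norm_mult intro!: mult_right_mono g(3))
  have "(LINT u|lborel. complex_of_real (exp (- (norm (u::'a))\<^sup>2 / 2))) = complex_of_real (sqrt (2 * pi) ^ DIM('a))"
    using integral_gaussian[of "0::'a"] by simp
  then have G: "(LINT u|lborel. g x * exp (- (norm (u::'a))\<^sup>2 / 2)) = g x * complex_of_real (sqrt (2 * pi) ^ DIM('a))"
    by simp
  have s: "sqrt (2 * pi) ^ DIM('a) * sqrt (2 * pi) ^ DIM('a) = (2 * pi) ^ DIM('a)"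
    by (simp only: power_mult_distrib[symmetric]) simp
  have "((\<lambda>\<epsilon>. LINT q|lborel. fourier g q * cis (q \<bullet> x) * exp (- (norm (\<epsilon> *\<^sub>R q))\<^sup>2 / 2)) \<longlongrightarrow>
      complex_of_real (sqrt (2 * pi) ^ DIM('a)) * (g x * complex_of_real (sqrt (2 * pi) ^ DIM('a)))) (at_right 0)"
  proof (rule Lim_transform_eventually)
    show "((\<lambda>\<epsilon>. complex_of_real (sqrt (2 * pi) ^ DIM('a)) * (LINT u|lborel. g (x + \<epsilon> *\<^sub>R u) * exp (- (norm u)\<^sup>2 / 2))) \<longlongrightarrow>
      complex_of_real (sqrt (2 * pi) ^ DIM('a)) * (g x * complex_of_real (sqrt (2 * pi) ^ DIM('a)))) (at_right 0)"
      using 2 unfolding G by (rule tendsto_mult_left)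
  qed (use fourier_gaussian_regularised[OF g(1)] in \<open>auto intro!: eventually_at_rightI[of 0 1]\<close>)
  from tendsto_unique[OF _ 1 this]
  have "(LINT q|lborel. fourier g q * cis (q \<bullet> x)) =
      complex_of_real (sqrt (2 * pi) ^ DIM('a) * sqrt (2 * pi) ^ DIM('a)) * g x"
    by (simp add: mult_ac)
  then show ?thesis unfolding s .
qed

subsection \<open>Polar coordinates\<close>

lemma sets_sphere_measure [measurable_cong, simp]: "sets sphere_measure = sets borel"
  and space_sphere_measure [simp]: "space sphere_measure = UNIV"
  by (simp_all add: sphere_measure_def)

lemma borel_measurable_sgn_euclidean [measurable]: "(sgn :: 'a::euclidean_space \<Rightarrow> 'a) \<in> borel_measurable borel"
  unfolding sgn_div_norm[abs_def] by measurable

lemma borel_measurable_sphere_density: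
  "(\<lambda>y :: 'a::euclidean_space. of_nat n * indicator (cball 0 1) y :: ennreal) \<in> borel_measurable borel"
  by (intro borel_measurable_times_ennreal borel_measurable_const borel_measurable_indicator) auto

lemma nn_integral_sphere_measure:
  fixes h :: "real ^ 'n \<Rightarrow> ennreal"
  assumes [measurable]: "h \<in> borel_measurable borel"
  shows "(\<integral>\<^sup>+p. h p \<partial>sphere_measure) =
    (\<integral>\<^sup>+y. (of_nat CARD('n) * indicator (cball 0 1) y) * h (sgn y) \<partial>lborel)"
proof -
  have "(\<integral>\<^sup>+p. h p \<partial>sphere_measure) =
      (\<integral>\<^sup>+y. h (sgn y) \<partial>density lborel (\<lambda>x. of_nat CARD('n) * indicator (cball 0 1) x))"
    unfolding sphere_measure_def by (rule nn_integral_distr) auto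
  also have "\<dots> = (\<integral>\<^sup>+y. (of_nat CARD('n) * indicator (cball 0 1) y) * h (sgn y) \<partial>lborel)"
    by (rule nn_integral_density) (auto intro: borel_measurable_sphere_density)
  finally show ?thesis .
qed

lemma finite_measure_sphere_measure: "finite_measure (sphere_measure :: (real ^ 'n) measure)"
proof
  have "emeasure sphere_measure (UNIV :: (real ^ 'n) set) = (\<integral>\<^sup>+p. 1 \<partial>(sphere_measure :: (real ^ 'n) measure))"
    by simp
  also have "\<dots> = of_nat CARD('n) * emeasure lborel (cball (0 :: real ^ 'n) 1)"
    by (subst nn_integral_sphere_measure) (simp_all add: nn_integral_cmult_indicator)
  also have "\<dots> < \<infinity>"
    using emeasure_lborel_cball_finite[of "0 :: real ^ 'n" 1] by (simp add: ennreal_mult_less_top less_top ennreal_of_nat_eq_real_of_nat)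
  finally show "emeasure sphere_measure (space sphere_measure :: (real ^ 'n) set) \<noteq> \<infinity>"
    by simp
qed

text \<open>The measure is defined on the whole space, and only the null set {0} is mapped off the
  unit sphere by \<open>sgn\<close>. Estimates for unit vectors can therefore be integrated.\<close>

lemma AE_sphere_measure: "AE p in (sphere_measure :: (real ^ 'n) measure). norm p = 1"
proof -
  have "AE y in (lborel :: (real ^ 'n) measure). y \<noteq> 0"
    by (rule AE_lborel_singleton)
  then show ?thesis
    unfolding sphere_measure_def
    by (subst AE_distr_iff) (auto simp: AE_density[OF borel_measurable_sphere_density[unfolded measurable_lborel2[symmetric]]] norm_sgn elim!: AE_mp)
qed

lemma nn_integral_lborel_affine:
  fixes h :: "'a::euclidean_space \<Rightarrow> ennreal"
  assumes [measurable]: "h \<in> borel_measurable borel" and "c \<noteq> 0"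
  shows "(\<integral>\<^sup>+t. h t \<partial>lborel) = (\<integral>\<^sup>+u. ennreal (\<bar>c\<bar> ^ DIM('a)) * h (a + c *\<^sub>R u) \<partial>lborel)"
  by (subst lborel_affine[OF \<open>c \<noteq> 0\<close>, of a])
     (simp add: nn_integral_density nn_integral_distr)

text \<open>The primitive \<open>- ((a / s) ^ n)\<close> rises from -1 to 0. For n = d the factor
  \<open>real n\<close> stems from the factor d in \<open>sphere_measure\<close>, which is thus the
  right normalisation for polar coordinates.\<close>

lemma nn_integral_power_tail:
  fixes a :: real
  assumes "a > 0" and "n > 0"
  shows "(\<integral>\<^sup>+s. ennreal (indicator {a..} s * (real n * a ^ n / s ^ (n + 1))) \<partial>lborel) = 1"
proof -
  obtain m where m: "n = Suc m" using \<open>n > 0\<close> gr0_implies_Suc by blast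
  have "(\<integral>\<^sup>+s. ennreal (real n * a ^ n / s ^ (n + 1)) * indicator {a..} s \<partial>lborel) =
    ennreal (0 - (- ((a / a) ^ n)))"
  proof (rule nn_integral_FTC_atLeast[where F = "\<lambda>s. - ((a / s) ^ n)"])
    show "((\<lambda>s. - ((a / s) ^ n)) has_real_derivative real n * a ^ n / s ^ (n + 1)) (at s)" if "a \<le> s" for s
    proof -
      have s: "s > 0" using that assms by simp
      then have "((\<lambda>s. - ((a / s) ^ n)) has_real_derivative
          - (real n * ((a / s) ^ (n - 1) * (- a / (s * s))))) (at s)"
        by (auto intro!: derivative_eq_intros)
      also have "- (real n * ((a / s) ^ (n - 1) * (- a / (s * s)))) = real n * a ^ n / s ^ (n + 1)"
        using s by (simp add: m power_divide mult_ac)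
      finally show ?thesis .
    qed
    show "0 \<le> real n * a ^ n / s ^ (n + 1)" if "a \<le> s" for s
      using that assms by simp
    have "((\<lambda>s. a / s) \<longlongrightarrow> 0) at_top"
      by (intro tendsto_divide_0[OF tendsto_const] filterlim_at_top_imp_at_infinity filterlim_ident)
    moreover have "- (0 ^ n) = (0 :: real)" using assms by simp
    ultimately show "((\<lambda>s. - ((a / s) ^ n)) \<longlongrightarrow> 0) at_top"
      using tendsto_minus[OF tendsto_power, of "\<lambda>s. a / s" 0 at_top n] by metis
  qed simp
  moreover have "(\<integral>\<^sup>+s. ennreal (indicator {a..} s * (real n * a ^ n / s ^ (n + 1))) \<partial>lborel) =
    (\<integral>\<^sup>+s. ennreal (real n * a ^ n / s ^ (n + 1)) * indicator {a..} s \<partial>lborel)"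
    by (intro nn_integral_cong) (simp split: split_indicator)
  ultimately show ?thesis
    using assms by simp
qed

text \<open>Substituting \<open>r = s |y|\<close> on the ray through \<open>y\<close>, exchanging the integrals and then substituting
  \<open>q = s y\<close> reduces the claim to \<open>\<integral> d |q|\<^sup>d s\<^bsup>-d-1\<^esup> ds = 1\<close> over \<open>s \<ge> |q|\<close>.\<close>

theorem nn_integral_polar:
  fixes h :: "real ^ 'n \<Rightarrow> ennreal"
  assumes [measurable]: "h \<in> borel_measurable borel"
  shows "(\<integral>\<^sup>+p. (\<integral>\<^sup>+r. ennreal (indicator {0<..} r * r ^ (CARD('n) - 1)) * h (r *\<^sub>R p) \<partial>lborel) \<partial>sphere_measure) =
    (\<integral>\<^sup>+q. h q \<partial>lborel)"
proof -
  let ?d = "CARD('n)"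
  \<comment> \<open>The density left after the substitution r = s |y|: d and the ball come from the
    sphere measure, one factor |y| from dr, and |y|^(d-1) s^(d-1) from the radial weight.\<close>
  let ?W = "\<lambda>s (y :: real ^ 'n). indicator {0<..} s * real ?d * (if norm y \<le> 1 then 1 else 0) * norm y ^ ?d * s ^ (?d - 1)"
  obtain m where d: "?d = Suc m" using zero_less_card_finite gr0_implies_Suc by blast
  have scale: "(of_nat ?d * indicator (cball 0 1) y) * (\<integral>\<^sup>+r. ennreal (indicator {0<..} r * r ^ (?d - 1)) * h (r *\<^sub>R sgn y) \<partial>lborel) =
     (\<integral>\<^sup>+s. ennreal (?W s y) * h (s *\<^sub>R y) \<partial>lborel)" if y: "y \<noteq> 0" for y :: "real ^ 'n"
  proof -
    have W: "(of_nat ?d * indicator (cball 0 1) y) * (ennreal (norm y) * (ennreal (indicator {0<..} (norm y * s) * (norm y * s) ^ (?d - 1)))) = ennreal (?W s y)" for s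
    proof -
      have "norm y * (norm y * s) ^ (?d - 1) = norm y ^ ?d * s ^ (?d - 1)"
        by (simp add: power_mult_distrib d)
      then show ?thesis
        using y by (auto simp: indicator_def zero_less_mult_iff ennreal_of_nat_eq_real_of_nat mult_ac simp flip: ennreal_mult)
    qed
    have ry: "(norm y * s) *\<^sub>R sgn y = s *\<^sub>R y" for s
      using y by (simp add: sgn_div_norm)
    have "(\<integral>\<^sup>+r. ennreal (indicator {0<..} r * r ^ (?d - 1)) * h (r *\<^sub>R sgn y) \<partial>lborel) =
       ennreal (norm y) * (\<integral>\<^sup>+s. ennreal (indicator {0<..} (norm y * s) * (norm y * s) ^ (?d - 1)) * h ((norm y * s) *\<^sub>R sgn y) \<partial>lborel)"
      using y by (subst nn_integral_real_affine[where c = "norm y" and t = 0]) auto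
    also have "\<dots> = (\<integral>\<^sup>+s. ennreal (norm y) * (ennreal (indicator {0<..} (norm y * s) * (norm y * s) ^ (?d - 1)) * h (s *\<^sub>R y)) \<partial>lborel)"
      using y by (subst nn_integral_cmult[symmetric]) (auto simp: ry)
    finally have "(of_nat ?d * indicator (cball 0 1) y) * (\<integral>\<^sup>+r. ennreal (indicator {0<..} r * r ^ (?d - 1)) * h (r *\<^sub>R sgn y) \<partial>lborel) =
       (of_nat ?d * indicator (cball 0 1) y) * (\<integral>\<^sup>+s. ennreal (norm y) * (ennreal (indicator {0<..} (norm y * s) * (norm y * s) ^ (?d - 1)) * h (s *\<^sub>R y)) \<partial>lborel)"
      by (rule arg_cong)
    also have "\<dots> = (\<integral>\<^sup>+s. (of_nat ?d * indicator (cball 0 1) y) * (ennreal (norm y) * (ennreal (indicator {0<..} (norm y * s) * (norm y * s) ^ (?d - 1)) * h (s *\<^sub>R y))) \<partial>lborel)"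
      by (rule nn_integral_cmult[symmetric]) measurable
    also have "\<dots> = (\<integral>\<^sup>+s. ennreal (?W s y) * h (s *\<^sub>R y) \<partial>lborel)"
      by (intro nn_integral_cong, subst W[symmetric]) (simp only: mult.assoc)
    finally show ?thesis .
  qed
  have "(\<integral>\<^sup>+p. (\<integral>\<^sup>+r. ennreal (indicator {0<..} r * r ^ (?d - 1)) * h (r *\<^sub>R p) \<partial>lborel) \<partial>sphere_measure) =
     (\<integral>\<^sup>+y. (\<integral>\<^sup>+s. ennreal (?W s y) * h (s *\<^sub>R y) \<partial>lborel) \<partial>lborel)"
  proof (subst nn_integral_sphere_measure)
    show "(\<lambda>p :: real ^ 'n. \<integral>\<^sup>+r. ennreal (indicator {0<..} r * r ^ (?d - 1)) * h (r *\<^sub>R p) \<partial>lborel) \<in> borel_measurable borel"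
      by measurable
  qed (rule nn_integral_cong_AE, rule AE_mp[OF AE_lborel_singleton[of 0]], intro AE_I2 impI scale)
  also have "\<dots> = (\<integral>\<^sup>+s. (\<integral>\<^sup>+y. ennreal (?W s y) * h (s *\<^sub>R y) \<partial>lborel) \<partial>lborel)"
    by (rule lborel_pair.Fubini') measurable
  \<comment> \<open>Under q = s y the unit ball condition becomes |q| \<le> s, which also excludes
    negative s. The powers s^(-d) from the measure, s^(-d) from |y|^d and s^(d-1) combine to
    s^(-d-1).\<close>
  also have "\<dots> = (\<integral>\<^sup>+s. (\<integral>\<^sup>+q. ennreal (indicator {norm q..} s * (real ?d * norm q ^ ?d / s ^ (?d + 1))) * h q \<partial>lborel) \<partial>lborel)"
  proof (rule nn_integral_cong_AE, rule AE_mp[OF AE_lborel_singleton[of 0]], intro AE_I2 impI)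
    fix s :: real assume s: "s \<noteq> 0"
    show "(\<integral>\<^sup>+y. ennreal (?W s y) * h (s *\<^sub>R y) \<partial>lborel) =
      (\<integral>\<^sup>+q. ennreal (indicator {norm q..} s * (real ?d * norm q ^ ?d / s ^ (?d + 1))) * h q \<partial>lborel)"
    proof (cases "s > 0")
      case True
      have "ennreal (\<bar>inverse s\<bar> ^ ?d) * (ennreal (?W s (inverse s *\<^sub>R q)) * h (s *\<^sub>R (inverse s *\<^sub>R q))) =
        ennreal (indicator {norm q..} s * (real ?d * norm q ^ ?d / s ^ (?d + 1))) * h q" for q :: "real ^ 'n"
      proof -
        have "\<bar>inverse s\<bar> ^ ?d * ?W s (inverse s *\<^sub>R q) = indicator {norm q..} s * (real ?d * norm q ^ ?d / s ^ (?d + 1))"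
          using True by (auto simp: indicator_def field_simps d)
        then show ?thesis
          using True by (simp add: mult.assoc[symmetric] ennreal_mult[symmetric] del: real_scaleR_def)
      qed
      then show ?thesis
        using s by (subst nn_integral_lborel_affine[of _ "inverse s" 0]) auto
    next
      case False
      then have "\<not> norm q \<le> s" for q :: "real ^ 'n"
        using s norm_ge_zero[of q] by linarith
      then show ?thesis using False by (simp add: indicator_def)
    qed
  qed
  also have "\<dots> = (\<integral>\<^sup>+q. (\<integral>\<^sup>+s. ennreal (indicator {norm q..} s * (real ?d * norm q ^ ?d / s ^ (?d + 1))) * h q \<partial>lborel) \<partial>lborel)"
    by (rule lborel_pair.Fubini') (simp add: indicator_def)
  \<comment> \<open>The null set q = 0 is removed because the tail integral has mass 1 only for a
    positive lower limit.\<close>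
  also have "\<dots> = (\<integral>\<^sup>+q. h q \<partial>lborel)"
    by (rule nn_integral_cong_AE, rule AE_mp[OF AE_lborel_singleton[of 0]], intro AE_I2 impI)
       (subst nn_integral_multc, simp, subst nn_integral_power_tail, auto)
  finally show ?thesis .
qed

text \<open>Making the weight part of a measure turns polar coordinates into a statement about a
  product measure, and the Laplace transform of this measure is the kernel of the jump.\<close>

definition radial_measure :: "nat \<Rightarrow> real measure" where
  "radial_measure n = density lborel (\<lambda>r. ennreal (indicator {0<..} r * r ^ n))"

lemma sets_radial_measure [measurable_cong, simp]: "sets (radial_measure n) = sets borel"
  and space_radial_measure [simp]: "space (radial_measure n) = UNIV"
  by (simp_all add: radial_measure_def)

lemma sigma_finite_radial_measure: "sigma_finite_measure (radial_measure n)"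
  unfolding radial_measure_def
  by (subst sigma_finite_measure.sigma_finite_iff_density_finite[OF lborel.sigma_finite_measure_axioms]) auto

text \<open>Nonnegative integrals of indicators already determine the measure. In the form of an
  equality with an image measure, the change of variables transports complex integrals together with
  their integrability.\<close>

theorem lborel_eq_polar:
  "distr (sphere_measure \<Otimes>\<^sub>M radial_measure (CARD('n) - 1)) borel (\<lambda>(p, r). r *\<^sub>R p) = (lborel :: (real ^ 'n) measure)"
proof (rule measure_eqI)
  interpret finite_measure "sphere_measure :: (real ^ 'n) measure" by (rule finite_measure_sphere_measure)
  interpret R: sigma_finite_measure "radial_measure (CARD('n) - 1)" by (rule sigma_finite_radial_measure)
  fix A assume "A \<in> sets (distr (sphere_measure \<Otimes>\<^sub>M radial_measure (CARD('n) - 1)) borel (\<lambda>(p, r). r *\<^sub>R p :: real ^ 'n))"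
  then have [measurable]: "A \<in> sets borel" by simp
  have "emeasure (distr (sphere_measure \<Otimes>\<^sub>M radial_measure (CARD('n) - 1)) borel (\<lambda>(p, r). r *\<^sub>R p)) A =
    (\<integral>\<^sup>+z. indicator A (snd z *\<^sub>R fst z) \<partial>(sphere_measure \<Otimes>\<^sub>M radial_measure (CARD('n) - 1)))"
    by (subst nn_integral_indicator[symmetric], simp, subst nn_integral_distr) (auto simp: case_prod_unfold)
  also have "\<dots> = (\<integral>\<^sup>+p. (\<integral>\<^sup>+r. indicator A (r *\<^sub>R p) \<partial>radial_measure (CARD('n) - 1)) \<partial>sphere_measure)"
    by (subst R.nn_integral_fst[symmetric]) auto
  also have "\<dots> = (\<integral>\<^sup>+p. (\<integral>\<^sup>+r. ennreal (indicator {0<..} r * r ^ (CARD('n) - 1)) * indicator A (r *\<^sub>R p) \<partial>lborel) \<partial>sphere_measure)"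
    unfolding radial_measure_def by (simp add: nn_integral_density)
  also have "\<dots> = emeasure lborel A"
    by (subst nn_integral_polar) auto
  finally show "emeasure (distr (sphere_measure \<Otimes>\<^sub>M radial_measure (CARD('n) - 1)) borel (\<lambda>(p, r). r *\<^sub>R p)) A = emeasure lborel A" .
qed simp

theorem integral_polar:
  fixes h :: "real ^ 'n \<Rightarrow> complex"
  assumes h: "integrable lborel h"
  shows "integrable sphere_measure (\<lambda>p. LINT r|radial_measure (CARD('n) - 1). h (r *\<^sub>R p))"
    and "(LINT p|sphere_measure. LINT r|radial_measure (CARD('n) - 1). h (r *\<^sub>R p)) = (LINT q|lborel. h q)"
proof -
  interpret S: finite_measure "sphere_measure :: (real ^ 'n) measure" by (rule finite_measure_sphere_measure)
  interpret R: sigma_finite_measure "radial_measure (CARD('n) - 1)" by (rule sigma_finite_radial_measure)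
  interpret pair_sigma_finite "sphere_measure :: (real ^ 'n) measure" "radial_measure (CARD('n) - 1)" ..
  have [measurable]: "h \<in> borel_measurable borel"
    using borel_measurable_integrable[OF h] by simp
  have i: "integrable (sphere_measure \<Otimes>\<^sub>M radial_measure (CARD('n) - 1)) (\<lambda>(p, r). h (r *\<^sub>R p))"
    using h by (subst (asm) lborel_eq_polar[symmetric], subst (asm) integrable_distr_eq) (auto simp: case_prod_unfold)
  show "integrable sphere_measure (\<lambda>p. LINT r|radial_measure (CARD('n) - 1). h (r *\<^sub>R p))"
    using integrable_fst'[OF i] by (simp add: case_prod_unfold)
  have "(LINT q|lborel. h q) = (LINT z|(sphere_measure \<Otimes>\<^sub>M radial_measure (CARD('n) - 1)). h (snd z *\<^sub>R fst z))"
    by (subst lborel_eq_polar[symmetric], subst integral_distr) (auto simp: case_prod_unfold)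
  also have "\<dots> = (LINT p|sphere_measure. LINT r|radial_measure (CARD('n) - 1). h (r *\<^sub>R p))"
    using integral_fst'[OF i] by (simp add: case_prod_unfold)
  finally show "(LINT p|sphere_measure. LINT r|radial_measure (CARD('n) - 1). h (r *\<^sub>R p)) = (LINT q|lborel. h q)" ..
qed

subsection \<open>Boundary values of the Stieltjes-Fantappie transform\<close>

lemma AE_radial_measure: "AE r in radial_measure n. r > 0"
  unfolding radial_measure_def by (subst AE_density) (auto intro!: AE_I2 simp: indicator_def)

lemma integrable_radial_measure_iff:
  fixes h :: "real \<Rightarrow> 'a::{banach, second_countable_topology}"
  assumes "h \<in> borel_measurable borel"
  shows "integrable (radial_measure n) h \<longleftrightarrow> integrable lborel (\<lambda>r. (indicator {0<..} r * r ^ n) *\<^sub>R h r)"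
  unfolding radial_measure_def using assms
  by (subst integrable_density) (auto simp: indicator_def)

lemma integral_radial_measure:
  fixes h :: "real \<Rightarrow> 'a::{banach, second_countable_topology}"
  assumes "h \<in> borel_measurable borel"
  shows "(LINT r|radial_measure n. h r) = (LINT r|lborel. (indicator {0<..} r * r ^ n) *\<^sub>R h r)"
  unfolding radial_measure_def using assms
  by (subst integral_density) (auto simp: indicator_def)

text \<open>Rescaling the variable by \<open>a\<close> reduces this to the Gamma integral.\<close>

lemma integrable_radial_exp:
  assumes "a > 0"
  shows "integrable (radial_measure n) (\<lambda>r. exp (- (a * r)))"
proof -
  have "integrable lborel (\<lambda>x. x ^ n * exp (- x) * indicator {0<..} x :: real)"
    using has_bochner_integral_I0i_power_exp_m by (auto simp: has_bochner_integral_iff)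
  from lborel_integrable_real_affine[OF this, of a 0]
  have "integrable lborel (\<lambda>r. inverse (a ^ n) * ((a * r) ^ n * exp (- (a * r)) * indicator {0<..} (a * r)))"
    using assms by (intro integrable_mult_right) simp
  moreover have "inverse (a ^ n) * ((a * r) ^ n * exp (- (a * r)) * indicator {0<..} (a * r)) =
      (indicator {0<..} r * r ^ n) *\<^sub>R exp (- (a * r))" for r
    using assms by (auto simp: indicator_def zero_less_mult_iff power_mult_distrib field_simps)
  ultimately show ?thesis
    by (subst integrable_radial_measure_iff) auto
qed

lemma integrable_radial_cexp:
  assumes "Re w > 0"
  shows "integrable (radial_measure n) (\<lambda>r. exp (- (w * complex_of_real r)))"
  by (rule Bochner_Integration.integrable_bound[OF integrable_radial_exp[OF assms, of n]]) auto

lemma power_cexp_tendsto_0: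
  assumes "Re w > 0"
  shows "((\<lambda>r. complex_of_real r ^ n * exp (- (w * complex_of_real r))) \<longlongrightarrow> 0) at_top"
proof (rule tendsto_norm_zero_cancel, rule Lim_transform_eventually)
  have "((\<lambda>r. (Re w * r) ^ n / exp (Re w * r)) \<longlongrightarrow> 0) at_top"
    by (rule filterlim_compose[OF tendsto_power_div_exp_0])
       (use assms in \<open>auto intro: filterlim_tendsto_pos_mult_at_top[OF tendsto_const _ filterlim_ident]\<close>)
  from tendsto_mult_left[OF this, of "inverse (Re w ^ n)"]
  show "((\<lambda>r. inverse (Re w ^ n) * ((Re w * r) ^ n / exp (Re w * r))) \<longlongrightarrow> 0) at_top"
    by simp
  show "\<forall>\<^sub>F r in at_top. inverse (Re w ^ n) * ((Re w * r) ^ n / exp (Re w * r)) =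
      norm (complex_of_real r ^ n * exp (- (w * complex_of_real r)))"
    using eventually_ge_at_top[of "0::real"]
    by eventually_elim (use assms in \<open>auto simp: norm_mult norm_divide norm_power power_mult_distrib exp_minus field_simps\<close>)
qed

text \<open>Since \<open>w\<close> is complex, a real rescaling does not reduce it to the Gamma
  integral. Instead, the fundamental theorem on the half-line is applied to r^(n+1) exp (- w r),
  which vanishes at both ends; this gives the recursion between consecutive exponents. For n = 0 the
  boundary value 1 at the origin starts it.\<close>

theorem laplace_radial:
  assumes w: "Re w > 0"
  shows "(LINT r|radial_measure n. exp (- (w * complex_of_real r))) = fact n / w ^ (n + 1)"
proof -
  have w0: "w \<noteq> 0" using w by auto
  let ?I = "\<lambda>n. LINT r|radial_measure n. exp (- (w * complex_of_real r))"
  let ?e = "\<lambda>n r. complex_of_real r ^ n * exp (- (w * complex_of_real r))"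
  have int: "set_integrable lborel {0<..} (?e n)" for n
    using integrable_radial_cexp[OF w, of n]
    by (subst (asm) integrable_radial_measure_iff)
       (auto simp: set_integrable_def scaleR_conv_of_real mult_ac)
  have I: "?I n = (LBINT r:{0<..}. ?e n r)" for n
    by (subst integral_radial_measure)
       (auto simp: set_lebesgue_integral_def scaleR_conv_of_real mult_ac)
  have FTC: "(LBINT r:{0<..}. F' r) = - F 0"
    if F: "\<And>r. (F has_vector_derivative F' r) (at r)" and c: "\<And>r. isCont F' r"
      and F': "set_integrable lborel {0<..} F'" and lim: "(F \<longlongrightarrow> 0) at_top" for F F' :: "real \<Rightarrow> complex"
  proof -
    have "isCont F 0" using F has_vector_derivative_continuous by blast
    then have "(LBINT r=0..\<infinity>. F' r) = 0 - F 0"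
    proof (intro interval_integral_FTC_integrable[where F = F] F c)
      show "((F \<circ> real_of_ereal) \<longlongrightarrow> F 0) (at_right 0)"
        using \<open>isCont F 0\<close> unfolding zero_ereal_def ereal_tendsto_simps
        by (simp add: isCont_def filterlim_at_split)
      show "((F \<circ> real_of_ereal) \<longlongrightarrow> 0) (at_left \<infinity>)"
        using lim unfolding ereal_tendsto_simps .
      show "set_integrable lborel (einterval 0 \<infinity>) F'"
        using F' unfolding zero_ereal_def einterval_eq .
    qed auto
    then show ?thesis by (simp add: interval_lebesgue_integral_0_infty)
  qed
  show ?thesis
  proof (induction n)
    case 0
    have "(LBINT r:{0<..}. - w * ?e 0 r) = - ?e 0 0"
      using set_integrable_mult_right[OF int[of 0], of "-w"] power_cexp_tendsto_0[OF w, of 0]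
      by (intro FTC) (auto intro!: derivative_eq_intros has_vector_derivative_real_field continuous_intros)
    moreover have "(LBINT r:{0<..}. - w * ?e 0 r) = - w * ?I 0"
      unfolding I by (rule set_integral_mult_right)
    ultimately show ?case
      using w0 by (simp add: field_simps)
  next
    case (Suc n)
    let ?F' = "\<lambda>r. of_nat (Suc n) * ?e n r - w * ?e (Suc n) r"
    have "(?e (Suc n) has_vector_derivative ?F' r) (at r)" for r
      by (rule has_vector_derivative_eq_rhs,
          rule has_vector_derivative_real_field[of "\<lambda>z. z ^ Suc n * exp (- (w * z))"])
         (auto intro!: derivative_eq_intros simp: algebra_simps simp del: power_Suc)
    then have "(LBINT r:{0<..}. ?F' r) = - ?e (Suc n) 0"
      using int power_cexp_tendsto_0[OF w, of "Suc n"]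
      by (intro FTC set_integral_diff set_integrable_mult_right) (auto intro!: continuous_intros simp del: power_Suc)
    also have "(LBINT r:{0<..}. ?F' r) = of_nat (Suc n) * ?I n - w * ?I (Suc n)"
      unfolding I using int by (subst set_integral_diff) (auto simp: set_integral_mult_right simp del: power_Suc)
    finally have "w * ?I (Suc n) = of_nat (Suc n) * (fact n / w ^ (n + 1))"
      unfolding Suc.IH by simp
    then show ?case
      using w0 by (simp add: field_simps)
  qed
qed

section \<open>Derivatives of the resolvent integral\<close>

lemma vector_derivative_resolvent_power:
  fixes c :: complex
  assumes "Im c \<noteq> 0"
  shows "((\<lambda>s. inverse ((complex_of_real s + c) ^ Suc k)) has_vector_derivative
    - of_nat (Suc k) * inverse ((complex_of_real s + c) ^ Suc (Suc k))) (at s within U)"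
proof -
  have nz: "complex_of_real s + c \<noteq> 0" using assms by (auto simp: complex_eq_iff)
  have "((\<lambda>z. inverse ((z + c) ^ Suc k)) has_field_derivative
     - of_nat (Suc k) * inverse ((complex_of_real s + c) ^ Suc (Suc k))) (at (complex_of_real s))"
  proof -
    define u where "u = complex_of_real s + c"
    have u: "u \<noteq> 0" using nz by (simp add: u_def)
    have "((\<lambda>z. inverse ((z + c) ^ Suc k)) has_field_derivative
       - (inverse (u ^ Suc k) * (of_nat (Suc k) * u ^ k) * inverse (u ^ Suc k))) (at (complex_of_real s))"
      unfolding u_def by (rule derivative_eq_intros refl | use nz in simp)+
    also have "- (inverse (u ^ Suc k) * (of_nat (Suc k) * u ^ k) * inverse (u ^ Suc k)) =
       - of_nat (Suc k) * inverse (u ^ Suc (Suc k))"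
      using u by (simp add: field_simps del: of_nat_Suc)
    finally show ?thesis by (simp only: u_def)
  qed
  then show ?thesis by (rule has_vector_derivative_real_field)
qed

text \<open>Off the real axis the kernel has no singularity, and compact support confines the
  integral to a box, so every derivative passes under the integral sign. The equality is one of
  functions of \<open>s\<close>, so that the induction step can differentiate it once more.\<close>

lemma higher_vector_derivative_integral_resolvent:
  fixes g :: "real ^ 'n \<Rightarrow> complex" and c :: complex
  assumes g: "continuous_on UNIV g" "\<And>t. norm t > R \<Longrightarrow> g t = 0" and c: "Im c \<noteq> 0"
  shows "higher_vector_derivative k (\<lambda>s. LINT t|lborel. g t / (complex_of_real s + c + complex_of_real (p \<bullet> t))) =
    (\<lambda>s. (-1) ^ k * fact k * (LINT t|lborel. g t * inverse ((complex_of_real s + c + complex_of_real (p \<bullet> t)) ^ Suc k)))"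
proof (induction k)
  case 0
  show ?case by (simp add: higher_vector_derivative_def field_simps)
next
  case (Suc k)
  obtain a where a: "cball 0 R \<subseteq> cbox (-a) (a :: real ^ 'n)"
    by (meson bounded_cball bounded_subset_cbox_symmetric)
  have z: "g t = 0" if "t \<notin> cbox (-a) a" for t
    using that a g(2)[of t] by (metis dist_0_norm mem_cball not_le subsetD)
  have nz: "complex_of_real s + c + complex_of_real (p \<bullet> t) \<noteq> 0" for s t
    using c by (auto simp: complex_eq_iff)
  define F where "F k s t = g t * inverse ((complex_of_real s + c + complex_of_real (p \<bullet> t)) ^ Suc k)" for k and s :: real and t
  have cF: "continuous_on X (\<lambda>(s, t). F k s t)" for k X
    unfolding F_def case_prod_beta
    by (intro continuous_intros continuous_on_compose2[OF g(1)]) (auto simp: nz)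
  have cF1: "continuous_on X (F k s)" for k s X
    unfolding F_def
    by (intro continuous_intros continuous_on_subset[OF g(1)]) (auto simp: nz)
  have eq: "(LINT t|lborel. F k s t) = integral (cbox (-a) a) (F k s)" for k s
    by (rule lebesgue_integral_eq_integral_compact_support[OF cF1 compact_cbox]) (simp add: F_def z)
  have der: "((\<lambda>s. LINT t|lborel. F k s t) has_vector_derivative
      (LINT t|lborel. - of_nat (Suc k) * F (Suc k) s t)) (at s)" for s
  proof -
    have "((\<lambda>s. integral (cbox (-a) a) (F k s)) has_vector_derivative
        integral (cbox (-a) a) (\<lambda>t. - of_nat (Suc k) * F (Suc k) s t)) (at s within UNIV)"
    proof (rule leibniz_rule_vector_derivative)
      fix s t
      have "((\<lambda>s. g t * inverse ((complex_of_real s + (c + complex_of_real (p \<bullet> t))) ^ Suc k)) has_vector_derivative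
          g t * (- of_nat (Suc k) * inverse ((complex_of_real s + (c + complex_of_real (p \<bullet> t))) ^ Suc (Suc k)))) (at s within UNIV)"
        by (intro has_vector_derivative_mult_right vector_derivative_resolvent_power) (simp add: c)
      then show "((\<lambda>s. F k s t) has_vector_derivative - of_nat (Suc k) * F (Suc k) s t) (at s within UNIV)"
        unfolding F_def by (simp only: add.assoc mult_ac)
    next
      show "F k s integrable_on cbox (-a) a" for s
        by (intro integrable_continuous cF1)
      show "continuous_on (UNIV \<times> cbox (-a) a) (\<lambda>(s, t). - of_nat (Suc k) * F (Suc k) s t)"
        using cF[of "UNIV \<times> cbox (-a) a" "Suc k"] unfolding case_prod_beta by (intro continuous_intros)
    qed auto
    then show ?thesis by (simp add: eq del: of_nat_Suc)
  qed
  have "higher_vector_derivative (Suc k) (\<lambda>s. LINT t|lborel. g t / (complex_of_real s + c + complex_of_real (p \<bullet> t))) =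
    (\<lambda>s. vector_derivative (\<lambda>s. (-1) ^ k * fact k * (LINT t|lborel. F k s t)) (at s))"
    using Suc.IH by (simp add: higher_vector_derivative_def F_def)
  also have "\<dots> = (\<lambda>s. (-1) ^ k * fact k * (LINT t|lborel. - of_nat (Suc k) * F (Suc k) s t))"
    by (intro ext vector_derivative_at has_vector_derivative_mult_right der)
  also have "\<dots> = (\<lambda>s. (-1) ^ Suc k * fact (Suc k) * (LINT t|lborel. F (Suc k) s t))"
    by (simp add: mult_ac del: of_nat_Suc)
  finally show ?case unfolding F_def .
qed

lemma borel_measurable_fourier [measurable]:
  assumes [measurable]: "g \<in> borel_measurable borel"
  shows "fourier g \<in> borel_measurable borel"
  unfolding fourier_def[abs_def] by measurable

text \<open>The sign \<open>\<sigma>\<close> selects the boundary value from below (\<open>1\<close>) or above (\<open>-1\<close>) the real axis.\<close>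

lemma resolvent_power_eq_laplace:
  assumes "\<eta> > 0" and s: "\<sigma> = 1 \<or> \<sigma> = -1"
  shows "fact n * inverse ((complex_of_real a - \<i> * \<sigma> * \<eta>) ^ Suc n) =
    (\<i> * complex_of_real \<sigma>) ^ Suc n * (LINT r|radial_measure n. complex_of_real (exp (- (\<eta> * r))) * cis (- (\<sigma> * a * r)))"
proof -
  \<comment> \<open>Multiplication by i \<sigma> rotates a - i \<sigma> \<eta> into the right
    half-plane: by \<sigma>^2 = 1 its real part becomes \<eta> > 0, and the Laplace integral
    converges.\<close>
  let ?w = "complex_of_real \<eta> + \<i> * \<sigma> * a"
  have w: "?w = (\<i> * \<sigma>) * (complex_of_real a - \<i> * \<sigma> * \<eta>)"
    using s by (auto simp: algebra_simps)
  have "exp (- (?w * complex_of_real r)) = complex_of_real (exp (- (\<eta> * r))) * cis (- (\<sigma> * a * r))" for r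
    by (simp add: cis_conv_exp exp_of_real[symmetric] exp_add[symmetric] algebra_simps)
  then have "(LINT r|radial_measure n. complex_of_real (exp (- (\<eta> * r))) * cis (- (\<sigma> * a * r))) = fact n / ?w ^ Suc n"
    using laplace_radial[of ?w n] assms by simp
  moreover have "(\<i> * complex_of_real \<sigma>) ^ Suc n \<noteq> 0" using s by auto
  ultimately show ?thesis
    unfolding w power_mult_distrib[of "\<i> * complex_of_real \<sigma>" "complex_of_real a - _"]
    by (simp add: divide_inverse del: power_Suc)
qed

text \<open>For fixed \<open>r\<close> the integral over \<open>t\<close> of the phase is the
  Fourier transform at the point \<sigma> r p. The factor exp (- \<eta> r) makes the double integral
  absolutely convergent.\<close>

lemma integral_resolvent_eq_fourier:
  fixes g :: "'a::euclidean_space \<Rightarrow> complex"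
  assumes g: "integrable lborel g" and \<eta>: "\<eta> > 0" and s: "\<sigma> = 1 \<or> \<sigma> = -1"
  shows "fact n * (LINT t|lborel. g t * inverse ((complex_of_real \<xi> - \<i> * \<sigma> * \<eta> + complex_of_real (p \<bullet> t)) ^ Suc n)) =
    (\<i> * complex_of_real \<sigma>) ^ Suc n *
      (LINT r|radial_measure n. complex_of_real (exp (- (\<eta> * r))) * (fourier g ((\<sigma> * r) *\<^sub>R p) * cis (- (\<sigma> * \<xi> * r))))"
proof -
  interpret R: sigma_finite_measure "radial_measure n" by (rule sigma_finite_radial_measure)
  interpret pair_sigma_finite "lborel :: 'a measure" "radial_measure n" ..
  have [measurable]: "g \<in> borel_measurable borel"
    using borel_measurable_integrable[OF g] by simp
  let ?H = "\<lambda>(t, r). g t * (complex_of_real (exp (- (\<eta> * r))) * cis (- (\<sigma> * (\<xi> + p \<bullet> t) * r)))"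
  have "integrable lborel (\<lambda>t. norm (g t))" using g by simp
  then have iH: "integrable (lborel \<Otimes>\<^sub>M radial_measure n) ?H"
    by (intro integrable_pair_mult_bound[OF _ _ _ integrable_radial_exp[OF \<eta>]])
       (auto simp: norm_mult lborel.sigma_finite_measure_axioms R.sigma_finite_measure_axioms)
  have "fact n * (LINT t|lborel. g t * inverse ((complex_of_real \<xi> - \<i> * \<sigma> * \<eta> + complex_of_real (p \<bullet> t)) ^ Suc n)) =
    (LINT t|lborel. g t * (fact n * inverse ((complex_of_real (\<xi> + p \<bullet> t) - \<i> * \<sigma> * \<eta>) ^ Suc n)))"
    by (subst integral_mult_right_zero[symmetric], intro Bochner_Integration.integral_cong)
       (auto simp: algebra_simps simp del: power_Suc)
  also have "\<dots> = (LINT t|lborel. (\<i> * complex_of_real \<sigma>) ^ Suc n * (LINT r|radial_measure n. ?H (t, r)))"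
    unfolding resolvent_power_eq_laplace[OF \<eta> s] by (simp add: mult_ac del: power_Suc)
  also have "\<dots> = (\<i> * complex_of_real \<sigma>) ^ Suc n * (LINT t|lborel. LINT r|radial_measure n. ?H (t, r))"
    by (rule integral_mult_right_zero)
  also have "(LINT t|lborel. LINT r|radial_measure n. ?H (t, r)) = (LINT r|radial_measure n. LINT t|lborel. ?H (t, r))"
    using Fubini_integral[of "\<lambda>t r. ?H (t, r)"] iH by simp
  also have "\<dots> = (LINT r|radial_measure n. complex_of_real (exp (- (\<eta> * r))) * (fourier g ((\<sigma> * r) *\<^sub>R p) * cis (- (\<sigma> * \<xi> * r))))"
  proof (intro Bochner_Integration.integral_cong refl)
    fix r
    have "(LINT t|lborel. ?H (t, r)) = (LINT t|lborel. (complex_of_real (exp (- (\<eta> * r))) * cis (- (\<sigma> * \<xi> * r))) * (g t * cis (- ((\<sigma> * r) *\<^sub>R p \<bullet> t))))"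
      by (intro Bochner_Integration.integral_cong refl) (auto simp: cis_mult algebra_simps)
    also have "\<dots> = (complex_of_real (exp (- (\<eta> * r))) * cis (- (\<sigma> * \<xi> * r))) * fourier g ((\<sigma> * r) *\<^sub>R p)"
      unfolding fourier_def by (rule integral_mult_right_zero)
    finally show "(LINT t|lborel. ?H (t, r)) = complex_of_real (exp (- (\<eta> * r))) * (fourier g ((\<sigma> * r) *\<^sub>R p) * cis (- (\<sigma> * \<xi> * r)))"
      by (simp only: mult_ac)
  qed
  finally show ?thesis .
qed

text \<open>For a unit vector \<open>p\<close>, the transform of \<open>g\<close> along the line
  through \<open>p\<close> is the one-dimensional Fourier transform of the Radon transform in that
  direction. The sign \<sigma> selects positive or negative frequencies, and the weight r^(d-1)
  corresponds to d - 1 derivatives.\<close>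

definition radial_fourier :: "(real ^ 'n \<Rightarrow> complex) \<Rightarrow> real \<Rightarrow> real ^ 'n \<Rightarrow> real \<Rightarrow> complex" where
  "radial_fourier g \<sigma> p \<xi> =
    (LINT r|radial_measure (CARD('n) - 1). fourier g ((\<sigma> * r) *\<^sub>R p) * cis (- (\<sigma> * \<xi> * r)))"

text \<open>In resolvent form the kernel becomes singular at \<xi> + p . t = 0 in the limit. On the
  Fourier side \<eta> occurs only in exp (- \<eta> r) \<le> 1, so the transform along the ray is a
  majorant.\<close>

lemma integral_resolvent_tendsto:
  fixes g :: "real ^ 'n \<Rightarrow> complex"
  assumes g: "integrable lborel g" and s: "\<sigma> = 1 \<or> \<sigma> = -1"
    and i: "integrable (radial_measure (CARD('n) - 1)) (\<lambda>r. fourier g ((\<sigma> * r) *\<^sub>R p))"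
  shows "((\<lambda>\<eta>. fact (CARD('n) - 1) * (LINT t|lborel. g t * inverse ((complex_of_real \<xi> - \<i> * \<sigma> * \<eta> + complex_of_real (p \<bullet> t)) ^ CARD('n)))) \<longlongrightarrow>
    (\<i> * complex_of_real \<sigma>) ^ CARD('n) * radial_fourier g \<sigma> p \<xi>) (at_right 0)"
proof -
  have d: "CARD('n) = Suc (CARD('n) - 1)" by simp
  have [measurable]: "g \<in> borel_measurable borel"
    using borel_measurable_integrable[OF g] by simp
  have "((\<lambda>\<eta>. LINT r|radial_measure (CARD('n) - 1). complex_of_real (exp (- (\<eta> * r))) * (fourier g ((\<sigma> * r) *\<^sub>R p) * cis (- (\<sigma> * \<xi> * r)))) \<longlongrightarrow>
     radial_fourier g \<sigma> p \<xi>) (at_right 0)"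
    unfolding radial_fourier_def
  proof (rule integral_dominated_convergence_at_right)
    show "integrable (radial_measure (CARD('n) - 1)) (\<lambda>r. norm (fourier g ((\<sigma> * r) *\<^sub>R p)))"
      using i by (rule integrable_norm)
    show "((\<lambda>\<eta>. complex_of_real (exp (- (\<eta> * r))) * (fourier g ((\<sigma> * r) *\<^sub>R p) * cis (- (\<sigma> * \<xi> * r)))) \<longlongrightarrow>
        fourier g ((\<sigma> * r) *\<^sub>R p) * cis (- (\<sigma> * \<xi> * r))) (at_right 0)" for r
      by (rule tendsto_eq_intros refl | simp)+
    show "AE r in radial_measure (CARD('n) - 1). norm (complex_of_real (exp (- (\<eta> * r))) * (fourier g ((\<sigma> * r) *\<^sub>R p) * cis (- (\<sigma> * \<xi> * r))))
        \<le> norm (fourier g ((\<sigma> * r) *\<^sub>R p))" if "\<eta> > 0" for \<eta>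
      using AE_radial_measure by eventually_elim (use that in \<open>auto simp: norm_mult mult_left_le_one_le\<close>)
  qed measurable
  from tendsto_mult_left[OF this, of "(\<i> * complex_of_real \<sigma>) ^ CARD('n)"]
  show ?thesis
    by (rule Lim_transform_eventually)
       (use integral_resolvent_eq_fourier[OF g _ s, where n = "CARD('n) - 1", unfolded d[symmetric]] in \<open>auto intro!: eventually_at_rightI[of 0 1]\<close>)
qed

section \<open>The jump function and its support\<close>

lemma higher_vector_derivative_SF_transform:
  fixes f :: "real ^ 'n \<Rightarrow> complex"
  assumes g_eq: "g = (\<lambda>t. if t \<in> pos_orthant then f t else 0)"
    and g: "continuous_on UNIV g" "\<And>t. norm t > R \<Longrightarrow> g t = 0" and c: "Im c \<noteq> 0"
  shows "higher_vector_derivative (CARD('n) - 1) (\<lambda>s. SF_transform f p (complex_of_real s + c)) \<xi> =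
    (-1) ^ (CARD('n) - 1) * (fact (CARD('n) - 1) *
      (LINT t|lborel. g t * inverse ((complex_of_real \<xi> + c + complex_of_real (p \<bullet> t)) ^ CARD('n))))"
proof -
  have "SF_transform f p z = (LINT t|lborel. g t / (z + complex_of_real (p \<bullet> t)))" for z
    unfolding SF_transform_def set_lebesgue_integral_def g_eq
    by (intro Bochner_Integration.integral_cong) (auto simp: indicator_def)
  moreover have d: "CARD('n) = Suc (CARD('n) - 1)" by simp
  ultimately show ?thesis
    using higher_vector_derivative_integral_resolvent[OF g c, where k = "CARD('n) - 1" and p = p]
    unfolding d[symmetric] by (simp add: mult.assoc)
qed

text \<open>The one-sided limits \<open>L\<close> stay abstract because they are computed in two
  ways: by the Fourier transform, and directly where the kernel stays regular on the
  support.\<close>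

lemma SF_jump_eqI:
  fixes f :: "real ^ 'n \<Rightarrow> complex"
  assumes g_eq: "g = (\<lambda>t. if t \<in> pos_orthant then f t else 0)"
    and g: "continuous_on UNIV g" "\<And>t. norm t > R \<Longrightarrow> g t = 0"
    and lim: "\<And>\<sigma>. \<sigma> = 1 \<or> \<sigma> = -1 \<Longrightarrow>
      ((\<lambda>\<eta>. fact (CARD('n) - 1) * (LINT t|lborel. g t * inverse ((complex_of_real \<xi> - \<i> * complex_of_real \<sigma> * complex_of_real \<eta> + complex_of_real (p \<bullet> t)) ^ CARD('n)))) \<longlongrightarrow> L \<sigma>) (at_right 0)"
  shows "SF_jump f p \<xi> = (-1) ^ (CARD('n) - 1) / complex_of_real pi * (L 1 - L (-1))"
proof -
  note hvd = higher_vector_derivative_SF_transform[where R = R, OF g_eq g]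
  have "((\<lambda>\<eta>. (-1) ^ (CARD('n) - 1) * (fact (CARD('n) - 1) * (LINT t|lborel. g t * inverse ((complex_of_real \<xi> - \<i> * complex_of_real 1 * complex_of_real \<eta> + complex_of_real (p \<bullet> t)) ^ CARD('n)))) -
     (-1) ^ (CARD('n) - 1) * (fact (CARD('n) - 1) * (LINT t|lborel. g t * inverse ((complex_of_real \<xi> - \<i> * complex_of_real (-1) * complex_of_real \<eta> + complex_of_real (p \<bullet> t)) ^ CARD('n)))))
     \<longlongrightarrow> (-1) ^ (CARD('n) - 1) * L 1 - (-1) ^ (CARD('n) - 1) * L (-1)) (at_right 0)"
    by (intro tendsto_diff tendsto_mult_left lim) auto
  then have "((\<lambda>\<eta>. higher_vector_derivative (CARD('n) - 1) (\<lambda>s. SF_transform f p (complex_of_real s - \<i> * complex_of_real \<eta>)) \<xi> -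
      higher_vector_derivative (CARD('n) - 1) (\<lambda>s. SF_transform f p (complex_of_real s + \<i> * complex_of_real \<eta>)) \<xi>)
     \<longlongrightarrow> (-1) ^ (CARD('n) - 1) * L 1 - (-1) ^ (CARD('n) - 1) * L (-1)) (at_right 0)"
  proof (rule Lim_transform_eventually, intro eventually_at_rightI[of 0 1])
    fix \<eta> :: real assume \<eta>: "\<eta> \<in> {0<..<1}"
    show "(-1) ^ (CARD('n) - 1) * (fact (CARD('n) - 1) * (LINT t|lborel. g t * inverse ((complex_of_real \<xi> - \<i> * complex_of_real 1 * complex_of_real \<eta> + complex_of_real (p \<bullet> t)) ^ CARD('n)))) -
     (-1) ^ (CARD('n) - 1) * (fact (CARD('n) - 1) * (LINT t|lborel. g t * inverse ((complex_of_real \<xi> - \<i> * complex_of_real (-1) * complex_of_real \<eta> + complex_of_real (p \<bullet> t)) ^ CARD('n)))) =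
     higher_vector_derivative (CARD('n) - 1) (\<lambda>s. SF_transform f p (complex_of_real s - \<i> * complex_of_real \<eta>)) \<xi> -
      higher_vector_derivative (CARD('n) - 1) (\<lambda>s. SF_transform f p (complex_of_real s + \<i> * complex_of_real \<eta>)) \<xi>"
      using hvd[where c = "- (\<i> * complex_of_real \<eta>)" and p = p and \<xi> = \<xi>]
        hvd[where c = "\<i> * complex_of_real \<eta>" and p = p and \<xi> = \<xi>] \<eta> by simp
  qed simp
  from tendsto_Lim[OF _ this] show ?thesis
    unfolding SF_jump_def by (simp add: algebra_simps)
qed

lemma SF_jump_eq_radial_fourier:
  fixes f :: "real ^ 'n \<Rightarrow> complex"
  assumes g_eq: "g = (\<lambda>t. if t \<in> pos_orthant then f t else 0)"
    and g: "continuous_on UNIV g" "\<And>t. norm t > R \<Longrightarrow> g t = 0"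
    and i: "\<And>\<sigma>. \<sigma> = 1 \<or> \<sigma> = -1 \<Longrightarrow> integrable (radial_measure (CARD('n) - 1)) (\<lambda>r. fourier g ((\<sigma> * r) *\<^sub>R p))"
  shows "SF_jump f p \<xi> = (-1) ^ (CARD('n) - 1) / complex_of_real pi *
    (\<i> ^ CARD('n) * radial_fourier g 1 p \<xi> - (- \<i>) ^ CARD('n) * radial_fourier g (-1) p \<xi>)"
proof -
  have "integrable lborel g"
    by (rule integrable_continuous_compact_support[OF g(1) compact_cball[of 0 R]]) (use g(2) in auto)
  from SF_jump_eqI[where R = R, OF g_eq g integral_resolvent_tendsto[OF this _ i]]
  show ?thesis by simp
qed

text \<open>On the support, |\<xi> + p . t| \<ge> |\<xi>| - R > 0, so the kernel extends
  continuously across the real axis. The limits from both sides coincide and cancel.\<close>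

lemma SF_jump_eq_0:
  fixes f :: "real ^ 'n \<Rightarrow> complex"
  assumes g_eq: "g = (\<lambda>t. if t \<in> pos_orthant then f t else 0)"
    and g: "continuous_on UNIV g" "\<And>t. norm t > R \<Longrightarrow> g t = 0"
    and p: "norm p \<le> 1" and \<xi>: "\<bar>\<xi>\<bar> > R" and R: "R \<ge> 0"
  shows "SF_jump f p \<xi> = 0"
proof -
  have i: "integrable lborel g"
    by (rule integrable_continuous_compact_support[OF g(1) compact_cball[of 0 R]]) (use g(2) in auto)
  then have [measurable]: "g \<in> borel_measurable borel"
    using borel_measurable_integrable by fastforce
  have lim: "((\<lambda>\<eta>. fact (CARD('n) - 1) * (LINT t|lborel. g t * inverse ((complex_of_real \<xi> - \<i> * complex_of_real \<sigma> * complex_of_real \<eta> + complex_of_real (p \<bullet> t)) ^ CARD('n)))) \<longlongrightarrow>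
     fact (CARD('n) - 1) * (LINT t|lborel. g t * inverse (complex_of_real (\<xi> + p \<bullet> t) ^ CARD('n)))) (at_right 0)" for \<sigma>
  proof (rule tendsto_mult_left, rule integral_dominated_convergence_at_right)
    have b: "\<bar>\<xi> + p \<bullet> t\<bar> \<ge> \<bar>\<xi>\<bar> - R" if "norm t \<le> R" for t
    proof -
      have "\<bar>p \<bullet> t\<bar> \<le> norm p * norm t" by (rule Cauchy_Schwarz_ineq2)
      also have "\<dots> \<le> 1 * R" using p that by (intro mult_mono) auto
      finally show ?thesis by linarith
    qed
    show "integrable lborel (\<lambda>t. norm (g t) * inverse ((\<bar>\<xi>\<bar> - R) ^ CARD('n)))"
      using i by simp
    show "((\<lambda>\<eta>. g t * inverse ((complex_of_real \<xi> - \<i> * complex_of_real \<sigma> * complex_of_real \<eta> + complex_of_real (p \<bullet> t)) ^ CARD('n))) \<longlongrightarrow>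
       g t * inverse (complex_of_real (\<xi> + p \<bullet> t) ^ CARD('n))) (at_right 0)" for t
    proof (cases "norm t \<le> R")
      case True
      then have "\<xi> + p \<bullet> t \<noteq> 0" using b[of t] \<xi> by auto
      then have "complex_of_real (\<xi> + p \<bullet> t) ^ CARD('n) \<noteq> 0"
        by (metis of_real_eq_0_iff power_not_zero)
      moreover have "((\<lambda>\<eta>. complex_of_real \<xi> - \<i> * complex_of_real \<sigma> * complex_of_real \<eta> + complex_of_real (p \<bullet> t)) \<longlongrightarrow>
         complex_of_real (\<xi> + p \<bullet> t)) (at_right 0)"
        by (rule tendsto_eq_intros refl | simp)+
      ultimately show ?thesis
        by (intro tendsto_mult_left tendsto_inverse tendsto_power)
    next
      case False
      then show ?thesis using g(2)[of t] by simp
    qed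
    show "AE t in lborel. norm (g t * inverse ((complex_of_real \<xi> - \<i> * complex_of_real \<sigma> * complex_of_real \<eta> + complex_of_real (p \<bullet> t)) ^ CARD('n)))
      \<le> norm (g t) * inverse ((\<bar>\<xi>\<bar> - R) ^ CARD('n))" for \<eta>
    proof (intro AE_I2)
      fix t
      let ?z = "complex_of_real \<xi> - \<i> * complex_of_real \<sigma> * complex_of_real \<eta> + complex_of_real (p \<bullet> t)"
      show "norm (g t * inverse (?z ^ CARD('n))) \<le> norm (g t) * inverse ((\<bar>\<xi>\<bar> - R) ^ CARD('n))"
      proof (cases "norm t \<le> R")
        case True
        have "\<bar>\<xi>\<bar> - R \<le> \<bar>Re ?z\<bar>" using b[OF True] by simp
        also have "\<dots> \<le> norm ?z" by (rule abs_Re_le_cmod)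
        finally have "(\<bar>\<xi>\<bar> - R) ^ CARD('n) \<le> norm ?z ^ CARD('n)"
          using \<xi> by (intro power_mono) auto
        then show ?thesis using \<xi>
          by (auto simp: norm_mult norm_inverse norm_power intro!: mult_left_mono le_imp_inverse_le)
      next
        case False
        then show ?thesis using g(2)[of t] by simp
      qed
    qed
  qed measurable
  show ?thesis
    using SF_jump_eqI[where R = R, OF g_eq g lim] by simp
qed

subsection \<open>Inversion\<close>

text \<open>The weight leaves decay r^(-2), comparable to the derivative of the arctangent. With n =
  d - 1 the exponent n + 2 is the decay order d + 1 of the Fourier transform.\<close>

lemma integrable_radial_rational:
  "integrable (radial_measure n) (\<lambda>r. 1 / (1 + r ^ (n + 2)))"
proof -
  have i: "integrable lborel (\<lambda>r. 2 * (indicator {0<..} r *\<^sub>R (1 / (1 + r\<^sup>2))) :: real)"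
    using integrable_I0i_1_div_plus_square
    unfolding interval_lebesgue_integral_0_infty set_integrable_def by (rule integrable_mult_right)
  have "r ^ n / (1 + r ^ (n + 2)) \<le> 2 / (1 + r\<^sup>2)" if "r > 0" for r :: real
  proof -
    have "r ^ n * (1 + r\<^sup>2) \<le> 2 * (1 + r ^ (n + 2))"
    proof (cases "r \<le> 1")
      case True
      have "r ^ n \<le> 1" "r\<^sup>2 \<le> 1" using that True by (auto intro: power_le_one)
      then have "r ^ n * (1 + r\<^sup>2) \<le> 1 * 2" using that by (intro mult_mono) auto
      then show ?thesis using that by (smt (verit) zero_le_power)
    next
      case False
      then have "r ^ n \<le> r ^ (n + 2)" by (intro power_increasing) auto
      then show ?thesis by (simp add: algebra_simps power_add power2_eq_square)
    qed
    moreover have "1 + r ^ (n + 2) > 0" "1 + r\<^sup>2 > 0"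
      using that by (auto intro: add_pos_pos)
    ultimately show ?thesis by (simp add: field_simps)
  qed
  then have "integrable lborel (\<lambda>r. (indicator {0<..} r * r ^ n) *\<^sub>R (1 / (1 + r ^ (n + 2))))"
    by (intro Bochner_Integration.integrable_bound[OF i] AE_I2) (auto simp: indicator_def)
  then show ?thesis
    by (subst integrable_radial_measure_iff) auto
qed

text \<open>The decay estimate yields this for every direction \<open>p\<close>; Fubini's theorem
  would yield it only for almost every one.\<close>

lemma integrable_radial_fourier:
  fixes g :: "real ^ 'n \<Rightarrow> complex"
  assumes [measurable]: "g \<in> borel_measurable borel"
    and C: "\<And>q. norm (fourier g q) \<le> C / (1 + norm q ^ (CARD('n) + 1))"
    and p: "norm p = 1" and s: "\<sigma> = 1 \<or> \<sigma> = -1"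
  shows "integrable (radial_measure (CARD('n) - 1)) (\<lambda>r. fourier g ((\<sigma> * r) *\<^sub>R p))"
proof (rule Bochner_Integration.integrable_bound)
  show "integrable (radial_measure (CARD('n) - 1)) (\<lambda>r. C * (1 / (1 + r ^ (CARD('n) - 1 + 2))))"
    by (intro integrable_mult_right integrable_radial_rational)
  show "AE r in radial_measure (CARD('n) - 1). norm (fourier g ((\<sigma> * r) *\<^sub>R p)) \<le> norm (C * (1 / (1 + r ^ (CARD('n) - 1 + 2))))"
    using AE_radial_measure
  proof eventually_elim
    case (elim r)
    have "norm ((\<sigma> * r) *\<^sub>R p) = r" using p s elim by auto
    then have "norm (fourier g ((\<sigma> * r) *\<^sub>R p)) \<le> C / (1 + r ^ (CARD('n) + 1))"
      using C[of "(\<sigma> * r) *\<^sub>R p"] by simp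
    also have "\<dots> = C * (1 / (1 + r ^ (CARD('n) - 1 + 2)))" by simp
    also have "\<dots> \<le> norm (C * (1 / (1 + r ^ (CARD('n) - 1 + 2))))"
      by (simp only: real_norm_def abs_ge_self)
    finally show ?case .
  qed
qed measurable

text \<open>In polar coordinates the decay bound depends on \<open>r\<close> alone, so the integral
  is at most the finite mass of the sphere times a convergent radial integral.\<close>

lemma integrable_fourier:
  fixes g :: "real ^ 'n \<Rightarrow> complex"
  assumes [measurable]: "g \<in> borel_measurable borel"
    and C: "\<And>q. norm (fourier g q) \<le> C / (1 + norm q ^ (CARD('n) + 1))"
  shows "integrable lborel (fourier g)"
proof (rule integrableI_bounded)
  interpret S: finite_measure "sphere_measure :: (real ^ 'n) measure" by (rule finite_measure_sphere_measure)
  let ?K = "\<integral>\<^sup>+r. ennreal (indicator {0<..} r * r ^ (CARD('n) - 1)) * ennreal (C * (1 / (1 + r ^ (CARD('n) - 1 + 2)))) \<partial>lborel"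
  have i: "integrable (radial_measure (CARD('n) - 1)) (\<lambda>r. C * (1 / (1 + r ^ (CARD('n) - 1 + 2))))"
    by (intro integrable_mult_right integrable_radial_rational)
  have "?K = (\<integral>\<^sup>+r. ennreal (C * (1 / (1 + r ^ (CARD('n) - 1 + 2)))) \<partial>radial_measure (CARD('n) - 1))"
    unfolding radial_measure_def by (subst nn_integral_density) auto
  also have "\<dots> \<le> (\<integral>\<^sup>+r. ennreal (norm (C * (1 / (1 + r ^ (CARD('n) - 1 + 2))))) \<partial>radial_measure (CARD('n) - 1))"
    by (intro nn_integral_mono ennreal_leI) (simp only: real_norm_def abs_ge_self)
  also have "\<dots> < \<infinity>" using i by (simp add: integrable_iff_bounded)
  finally have K: "?K < \<infinity>" .
  have "(\<integral>\<^sup>+q. ennreal (norm (fourier g q)) \<partial>lborel) =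
    (\<integral>\<^sup>+p. (\<integral>\<^sup>+r. ennreal (indicator {0<..} r * r ^ (CARD('n) - 1)) * ennreal (norm (fourier g (r *\<^sub>R p))) \<partial>lborel) \<partial>sphere_measure)"
    by (rule nn_integral_polar[symmetric]) measurable
  also have "\<dots> \<le> (\<integral>\<^sup>+p. ?K \<partial>(sphere_measure :: (real ^ 'n) measure))"
  proof (rule nn_integral_mono_AE, use AE_sphere_measure in eventually_elim)
    fix p :: "real ^ 'n" assume p: "norm p = 1"
    show "(\<integral>\<^sup>+r. ennreal (indicator {0<..} r * r ^ (CARD('n) - 1)) * ennreal (norm (fourier g (r *\<^sub>R p))) \<partial>lborel) \<le> ?K"
    proof (rule nn_integral_mono)
      fix r :: real
      have "norm (fourier g (r *\<^sub>R p)) \<le> C * (1 / (1 + r ^ (CARD('n) - 1 + 2)))" if "r > 0"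
        using C[of "r *\<^sub>R p"] p that by simp
      then show "ennreal (indicator {0<..} r * r ^ (CARD('n) - 1)) * ennreal (norm (fourier g (r *\<^sub>R p))) \<le>
          ennreal (indicator {0<..} r * r ^ (CARD('n) - 1)) * ennreal (C * (1 / (1 + r ^ (CARD('n) - 1 + 2))))"
        by (cases "r > 0") (auto intro!: mult_left_mono ennreal_leI)
    qed
  qed
  also have "\<dots> = ?K * emeasure (sphere_measure :: (real ^ 'n) measure) UNIV" by simp
  also have "\<dots> < \<infinity>"
    using K top.not_eq_extremum[THEN iffD1, OF S.emeasure_finite, of UNIV] by (simp add: ennreal_mult_less_top)
  finally show "(\<integral>\<^sup>+q. ennreal (norm (fourier g q)) \<partial>lborel) < \<infinity>" .
qed measurable

text \<open>At \<xi> = - p . x the phase equals that of the inversion integrand at q = \<sigma> r p,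
  so polar coordinates recover the whole inversion integral. The reflection q to - q preserves
  Lebesgue measure, so both signs give the same value.\<close>

lemma integral_sphere_radial_fourier:
  fixes g :: "real ^ 'n \<Rightarrow> complex"
  assumes g: "integrable lborel g" "continuous_on UNIV g" "\<And>t. norm (g t) \<le> B"
    and fg: "integrable lborel (fourier g)" and s: "\<sigma> = 1 \<or> \<sigma> = -1"
  shows "integrable sphere_measure (\<lambda>p. radial_fourier g \<sigma> p (- (p \<bullet> x)))" (is ?A)
    and "(LINT p|sphere_measure. radial_fourier g \<sigma> p (- (p \<bullet> x))) = complex_of_real ((2 * pi) ^ CARD('n)) * g x" (is ?B)
proof -
  let ?h = "\<lambda>q. fourier g q * cis (q \<bullet> x)"
  have [measurable]: "g \<in> borel_measurable borel"
    using borel_measurable_integrable[OF g(1)] by simp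
  have i: "integrable lborel ?h"
    by (rule Bochner_Integration.integrable_bound[OF fg]) (auto simp: norm_mult)
  have s0: "\<sigma> \<noteq> 0" using s by auto
  have i2: "integrable lborel (\<lambda>q. ?h (0 + \<sigma> *\<^sub>R q))"
    by (rule integrable_lborel_affine[OF i s0])
  have e: "(LINT r|radial_measure (CARD('n) - 1). ?h (0 + \<sigma> *\<^sub>R (r *\<^sub>R p))) = radial_fourier g \<sigma> p (- (p \<bullet> x))" for p
    unfolding radial_fourier_def by (simp add: mult_ac)
  show ?A using integral_polar(1)[OF i2] unfolding e .
  have "(LINT q|lborel. ?h (0 + \<sigma> *\<^sub>R q)) = (LINT q|lborel. ?h q)"
    by (subst lborel_integral_affine[of ?h \<sigma> 0]) (use s s0 in auto)
  then show ?B using integral_polar(2)[OF i2] fourier_inversion[OF g fg, of x] unfolding e by simp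
qed

section \<open>Truncated principal values and the sine integral\<close>

lemma integral_sin_over:
  assumes "0 < \<epsilon>" "\<epsilon> \<le> T"
  shows "(LBINT s:{\<epsilon><..<T}. sin (r * s) / s) = Si (r * T) - Si (r * \<epsilon>)"
proof -
  have "(LBINT s=\<epsilon>..T. sin (r * s) / s) = Si (r * T) - Si (r * \<epsilon>)"
  proof (rule interval_integral_FTC_finite)
    show "continuous_on {min \<epsilon> T..max \<epsilon> T} (\<lambda>s. sin (r * s) / s)"
      using assms by (intro continuous_intros) auto
    fix s assume s: "min \<epsilon> T \<le> s" "s \<le> max \<epsilon> T"
    have "((\<lambda>s. Si (r * s)) has_real_derivative sinc (r * s) * r) (at s within {min \<epsilon> T..max \<epsilon> T})"
      by (rule DERIV_chain2[OF DERIV_Si]) (auto intro!: derivative_eq_intros)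
    moreover have "sinc (r * s) * r = sin (r * s) / s"
      using s assms by (auto simp: min_def split: if_splits)
    ultimately show "((\<lambda>s. Si (r * s)) has_vector_derivative sin (r * s) / s) (at s within {min \<epsilon> T..max \<epsilon> T})"
      by (simp add: has_real_derivative_iff_has_vector_derivative)
  qed
  then show ?thesis
    using assms by (simp add: interval_lebesgue_integral_le_eq)
qed

lemma integrable_indicator_Ioo: "integrable lborel (\<lambda>s::real. indicator {a<..<b} s *\<^sub>R (c::real))"
  by (rule integrable_scaleR_left, rule integrable_real_indicator, simp)
     (use emeasure_bounded_finite[of "{a<..<b}"] in simp)

text \<open>Folding the negative half onto the positive one cancels the cosine, because 1 / s is
  odd, and doubles the sine.\<close>

lemma integral_annulus_cis_over:
  assumes \<epsilon>: "0 < \<epsilon>" "\<epsilon> \<le> T"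
  shows "(LBINT s:{s. \<epsilon> < \<bar>s\<bar> \<and> \<bar>s\<bar> < T}. cis (r * s) / complex_of_real s) =
    2 * \<i> * complex_of_real (Si (r * T) - Si (r * \<epsilon>))"
proof -
  let ?f = "\<lambda>s. cis (r * s) / complex_of_real s"
  have b: "integrable lborel (\<lambda>s. indicator {a<..<b} s *\<^sub>R (1 / \<epsilon>))" for a b :: real
    by (rule integrable_indicator_Ioo)
  have bound: "norm (?f s) \<le> 1 / \<epsilon>" if "\<epsilon> < \<bar>s\<bar>" for s
    using that \<epsilon> frac_le[of 1 1 \<epsilon> "\<bar>s\<bar>"] by (simp add: norm_divide)
  have i1: "set_integrable lborel {\<epsilon><..<T} ?f"
    unfolding set_integrable_def
    by (rule Bochner_Integration.integrable_bound[OF b[of \<epsilon> T]])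
       (use \<epsilon> in \<open>auto intro!: AE_I2 bound[THEN order_trans] split: split_indicator simp del: norm_divide\<close>)
  have i2: "set_integrable lborel {-T<..<-\<epsilon>} ?f"
    unfolding set_integrable_def
    by (rule Bochner_Integration.integrable_bound[OF b[of "-T" "-\<epsilon>"]])
       (use \<epsilon> in \<open>auto intro!: AE_I2 bound[THEN order_trans] split: split_indicator simp del: norm_divide\<close>)
  have "set_integrable lborel {\<epsilon><..<T} (\<lambda>s. ?f (- s))"
    using lborel_integrable_real_affine[OF i2[unfolded set_integrable_def], of "-1" 0]
    unfolding set_integrable_def by (simp add: indicator_def minus_less_iff less_minus_iff conj_commute)
  note i3 = this
  have "{s. \<epsilon> < \<bar>s\<bar> \<and> \<bar>s\<bar> < T} = {\<epsilon><..<T} \<union> {-T<..<-\<epsilon>}"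
    using \<epsilon> by auto
  then have "(LBINT s:{s. \<epsilon> < \<bar>s\<bar> \<and> \<bar>s\<bar> < T}. ?f s) = (LBINT s:{\<epsilon><..<T}. ?f s) + (LBINT s:{-T<..<-\<epsilon>}. ?f s)"
    using set_integral_Un[OF _ i1 i2] \<epsilon> by auto
  also have "(LBINT s:{-T<..<-\<epsilon>}. ?f s) = (LBINT s:{\<epsilon><..<T}. ?f (- s))"
    unfolding set_lebesgue_integral_def
    by (subst lborel_integral_real_affine[of "-1" _ 0])
       (auto simp: indicator_def intro!: Bochner_Integration.integral_cong)
  also have "(LBINT s:{\<epsilon><..<T}. ?f s) + (LBINT s:{\<epsilon><..<T}. ?f (- s)) = (LBINT s:{\<epsilon><..<T}. ?f s + ?f (- s))"
    by (rule set_integral_add(2)[symmetric, OF i1 i3])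
  also have "\<dots> = (LBINT s:{\<epsilon><..<T}. (2 * \<i>) * complex_of_real (sin (r * s) / s))"
  proof -
    have "?f s + ?f (- s) = (2 * \<i>) * complex_of_real (sin (r * s) / s)" for s
      by (cases "s = 0") (auto simp: complex_eq_iff)
    then show ?thesis by simp
  qed
  also have "\<dots> = 2 * \<i> * complex_of_real (LBINT s:{\<epsilon><..<T}. sin (r * s) / s)"
    unfolding set_integral_mult_right set_integral_complex_of_real ..
  finally show ?thesis unfolding integral_sin_over[OF \<epsilon>] .
qed

text \<open>The outer radius \<open>1 / \<epsilon>\<close> makes Fubini's theorem applicable; it is harmless below because the jump
  function has compact support.\<close>

lemma annulus_integral_tendsto:
  fixes u :: "real \<Rightarrow> complex"
  assumes u: "integrable (radial_measure n) u" and s: "\<sigma> = 1 \<or> \<sigma> = -1"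
  shows "\<epsilon> > 0 \<Longrightarrow> set_integrable lborel {s. \<epsilon> < \<bar>s\<bar> \<and> \<bar>s\<bar> < 1 / \<epsilon>}
      (\<lambda>s. (LINT r|radial_measure n. u r * cis (\<sigma> * r * s)) / complex_of_real s)"
    and "((\<lambda>\<epsilon>. LBINT s:{s. \<epsilon> < \<bar>s\<bar> \<and> \<bar>s\<bar> < 1 / \<epsilon>}. (LINT r|radial_measure n. u r * cis (\<sigma> * r * s)) / complex_of_real s)
      \<longlongrightarrow> \<i> * complex_of_real pi * complex_of_real \<sigma> * (LINT r|radial_measure n. u r)) (at_right 0)"
proof -
  interpret R: sigma_finite_measure "radial_measure n" by (rule sigma_finite_radial_measure)
  interpret pair_sigma_finite "radial_measure n" "lborel :: real measure" ..
  have [measurable]: "u \<in> borel_measurable borel"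
    using borel_measurable_integrable[OF u] by (simp cong: measurable_cong_sets)
  define H where "H \<epsilon> r s = u r * (indicator {s. \<epsilon> < \<bar>s\<bar> \<and> \<bar>s\<bar> < 1 / \<epsilon>} s * (cis (\<sigma> * r * s) / complex_of_real s))" for \<epsilon> r s :: real
  have [measurable]: "(\<lambda>(r, s). H \<epsilon> r s) \<in> borel_measurable (borel \<Otimes>\<^sub>M borel)" for \<epsilon>
    unfolding H_def indicator_def by measurable
  have iH: "integrable (radial_measure n \<Otimes>\<^sub>M lborel) (\<lambda>(r, s). H \<epsilon> r s)" if "\<epsilon> > 0" for \<epsilon>
  proof (rule integrable_pair_mult_bound)
    show "integrable (radial_measure n) (\<lambda>r. norm (u r))" using u by simp
    show "integrable lborel (\<lambda>s. indicator {-1/\<epsilon><..<1/\<epsilon>} s *\<^sub>R (1 / \<epsilon>))"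
      by (rule integrable_indicator_Ioo)
    show "norm (case (r, s) of (r, s) \<Rightarrow> H \<epsilon> r s) \<le> norm (norm (u r)) * norm (indicator {-1/\<epsilon><..<1/\<epsilon>} s *\<^sub>R (1 / \<epsilon>))" for r s
      using that unfolding H_def
      by (auto simp: norm_mult norm_divide indicator_def intro!: mult_left_mono divide_left_mono)
  qed (auto simp: R.sigma_finite_measure_axioms lborel.sigma_finite_measure_axioms)
  have in1: "(LINT r|radial_measure n. H \<epsilon> r s) = indicator {s. \<epsilon> < \<bar>s\<bar> \<and> \<bar>s\<bar> < 1 / \<epsilon>} s *\<^sub>R
     ((LINT r|radial_measure n. u r * cis (\<sigma> * r * s)) / complex_of_real s)" for \<epsilon> s
    by (auto simp: H_def indicator_def)
  show "\<epsilon> > 0 \<Longrightarrow> set_integrable lborel {s. \<epsilon> < \<bar>s\<bar> \<and> \<bar>s\<bar> < 1 / \<epsilon>}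
      (\<lambda>s. (LINT r|radial_measure n. u r * cis (\<sigma> * r * s)) / complex_of_real s)"
    using integrable_snd[OF iH] unfolding in1 set_integrable_def .
  have eq: "(LBINT s:{s. \<epsilon> < \<bar>s\<bar> \<and> \<bar>s\<bar> < 1 / \<epsilon>}. (LINT r|radial_measure n. u r * cis (\<sigma> * r * s)) / complex_of_real s) =
      (LINT r|radial_measure n. u r * (2 * \<i> * complex_of_real (Si (\<sigma> * r * (1 / \<epsilon>)) - Si (\<sigma> * r * \<epsilon>))))"
    if \<epsilon>: "0 < \<epsilon>" "\<epsilon> < 1" for \<epsilon>
  proof -
    \<comment> \<open>\<epsilon> < 1 keeps the outer radius above the inner one.\<close>
    have "\<epsilon> \<le> 1 / \<epsilon>" using \<epsilon> by (simp add: field_simps mult_le_one)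
    note annulus = integral_annulus_cis_over[OF \<epsilon>(1) this]
    have in2: "(LINT s|lborel. H \<epsilon> r s) = u r * (2 * \<i> * complex_of_real (Si (\<sigma> * r * (1 / \<epsilon>)) - Si (\<sigma> * r * \<epsilon>)))" for r
      unfolding annulus[symmetric] H_def set_lebesgue_integral_def
      by (subst integral_mult_right_zero[symmetric]) (auto intro!: Bochner_Integration.integral_cong simp: indicator_def)
    show ?thesis
      unfolding in2[symmetric] Fubini_integral[OF iH[OF \<epsilon>(1)], symmetric] in1 set_lebesgue_integral_def ..
  qed
  \<comment> \<open>Boundedness of \<open>Si\<close> replaces the missing absolute convergence: the
    majorant 4 B |u| depends on neither \<epsilon> nor the phase.\<close>
  obtain B where B: "\<And>T. \<bar>Si T\<bar> \<le> B" using bounded_Si by blast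
  have Si_sgn: "Si (\<sigma> * T) = \<sigma> * Si T" if "T \<ge> 0" for T
    using s Si_neg[OF that] by auto
  \<comment> \<open>The convergence theorem asks for a pointwise limit at every r, but the value
    \<sigma> pi / 2 is correct only for r > 0. The indicator enforces it everywhere and is dropped
    afterwards, as the radial measure does not charge r \<le> 0.\<close>
  have "((\<lambda>\<epsilon>. LINT r|radial_measure n. u r * (2 * \<i> * complex_of_real (indicator {0<..} r * (Si (\<sigma> * r * (1 / \<epsilon>)) - Si (\<sigma> * r * \<epsilon>)))))
      \<longlongrightarrow> (LINT r|radial_measure n. u r * (2 * \<i> * complex_of_real (indicator {0<..} r * (\<sigma> * (pi / 2)))))) (at_right 0)"
  proof (rule integral_dominated_convergence_at_right)
    show "integrable (radial_measure n) (\<lambda>r. norm (u r) * (4 * B))" using u by simp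
    show "AE r in radial_measure n. norm (u r * (2 * \<i> * complex_of_real (indicator {0<..} r * (Si (\<sigma> * r * (1 / \<epsilon>)) - Si (\<sigma> * r * \<epsilon>))))) \<le> norm (u r) * (4 * B)" for \<epsilon>
    proof (intro AE_I2)
      fix r
      have "\<bar>Si (\<sigma> * r * (1 / \<epsilon>)) - Si (\<sigma> * r * \<epsilon>)\<bar> \<le> 2 * B"
        using B[of "\<sigma> * r * (1 / \<epsilon>)"] B[of "\<sigma> * r * \<epsilon>"] by linarith
      moreover have "0 \<le> B" using B[of 0] by linarith
      ultimately have "2 * (indicator {0<..} r * \<bar>Si (\<sigma> * r * (1 / \<epsilon>)) - Si (\<sigma> * r * \<epsilon>)\<bar>) \<le> 4 * B"
        by (auto simp: indicator_def)
      then have "norm (u r) * (2 * (indicator {0<..} r * \<bar>Si (\<sigma> * r * (1 / \<epsilon>)) - Si (\<sigma> * r * \<epsilon>)\<bar>)) \<le> norm (u r) * (4 * B)"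
        by (rule mult_left_mono) simp
      then show "norm (u r * (2 * \<i> * complex_of_real (indicator {0<..} r * (Si (\<sigma> * r * (1 / \<epsilon>)) - Si (\<sigma> * r * \<epsilon>))))) \<le> norm (u r) * (4 * B)"
        by (simp only: norm_mult norm_of_real abs_mult abs_indicator norm_numeral norm_ii mult_1_right)
    qed
    show "((\<lambda>\<epsilon>. u r * (2 * \<i> * complex_of_real (indicator {0<..} r * (Si (\<sigma> * r * (1 / \<epsilon>)) - Si (\<sigma> * r * \<epsilon>))))) \<longlongrightarrow>
      u r * (2 * \<i> * complex_of_real (indicator {0<..} r * (\<sigma> * (pi / 2))))) (at_right 0)" for r
    proof (cases "r > 0")
      case True
      have "filterlim (\<lambda>\<epsilon>. r * inverse \<epsilon>) at_top (at_right 0)"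
        by (rule filterlim_tendsto_pos_mult_at_top[OF tendsto_const True filterlim_inverse_at_top_right])
      from tendsto_mult_left[OF filterlim_compose[OF Si_at_top this], of \<sigma>]
      have 1: "((\<lambda>\<epsilon>. Si (\<sigma> * r * (1 / \<epsilon>))) \<longlongrightarrow> \<sigma> * (pi / 2)) (at_right 0)"
        by (rule Lim_transform_eventually)
           (use True in \<open>auto intro!: eventually_at_rightI[of 0 1] simp: mult.assoc Si_sgn divide_inverse\<close>)
      have "((\<lambda>\<epsilon>. \<sigma> * r * \<epsilon>) \<longlongrightarrow> 0) (at_right 0)"
        by (rule tendsto_eq_intros refl | simp)+
      then have "((\<lambda>\<epsilon>. Si (\<sigma> * r * \<epsilon>)) \<longlongrightarrow> Si 0) (at_right 0)"
        by (rule isCont_tendsto_compose[OF isCont_Si])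
      moreover have "Si 0 = 0" using Si_neg[of 0] by simp
      ultimately have "((\<lambda>\<epsilon>. Si (\<sigma> * r * (1 / \<epsilon>)) - Si (\<sigma> * r * \<epsilon>)) \<longlongrightarrow> \<sigma> * (pi / 2)) (at_right 0)"
        using tendsto_diff[OF 1] by fastforce
      then show ?thesis by (intro tendsto_mult_left tendsto_of_real)
    qed (simp add: indicator_def)
  qed measurable
  moreover have ind: "(LINT r|radial_measure n. u r * (2 * \<i> * complex_of_real (indicator {0<..} r * c r))) =
     (LINT r|radial_measure n. u r * (2 * \<i> * complex_of_real (c r)))" if [measurable]: "c \<in> borel_measurable borel" for c
  proof (rule integral_cong_AE)
    show "AE r in radial_measure n. u r * (2 * \<i> * complex_of_real (indicator {0<..} r * c r)) = u r * (2 * \<i> * complex_of_real (c r))"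
      using AE_radial_measure by eventually_elim simp
  qed measurable
  moreover have "(LINT r|radial_measure n. u r * (2 * \<i> * complex_of_real (indicator {0<..} r * (Si (\<sigma> * r * (1 / \<epsilon>)) - Si (\<sigma> * r * \<epsilon>))))) =
     (LINT r|radial_measure n. u r * (2 * \<i> * complex_of_real (Si (\<sigma> * r * (1 / \<epsilon>)) - Si (\<sigma> * r * \<epsilon>))))" for \<epsilon>
    by (rule ind) measurable
  moreover have "(LINT r|radial_measure n. u r * (2 * \<i> * complex_of_real (indicator {0<..} r * (\<sigma> * (pi / 2))))) =
     (LINT r|radial_measure n. u r * (2 * \<i> * complex_of_real (\<sigma> * (pi / 2))))"
    by (rule ind) measurable
  ultimately have "((\<lambda>\<epsilon>. LINT r|radial_measure n. u r * (2 * \<i> * complex_of_real (Si (\<sigma> * r * (1 / \<epsilon>)) - Si (\<sigma> * r * \<epsilon>))))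
      \<longlongrightarrow> (LINT r|radial_measure n. u r * (2 * \<i> * complex_of_real (\<sigma> * (pi / 2))))) (at_right 0)"
    by (simp only:)
  moreover have "(LINT r|radial_measure n. u r * (2 * \<i> * complex_of_real (\<sigma> * (pi / 2)))) =
      \<i> * complex_of_real pi * complex_of_real \<sigma> * (LINT r|radial_measure n. u r)"
    by (subst integral_mult_left_zero) simp
  ultimately have "((\<lambda>\<epsilon>. LINT r|radial_measure n. u r * (2 * \<i> * complex_of_real (Si (\<sigma> * r * (1 / \<epsilon>)) - Si (\<sigma> * r * \<epsilon>))))
      \<longlongrightarrow> \<i> * complex_of_real pi * complex_of_real \<sigma> * (LINT r|radial_measure n. u r)) (at_right 0)"
    by (simp only:)
  then show "((\<lambda>\<epsilon>. LBINT s:{s. \<epsilon> < \<bar>s\<bar> \<and> \<bar>s\<bar> < 1 / \<epsilon>}. (LINT r|radial_measure n. u r * cis (\<sigma> * r * s)) / complex_of_real s)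
      \<longlongrightarrow> \<i> * complex_of_real pi * complex_of_real \<sigma> * (LINT r|radial_measure n. u r)) (at_right 0)"
    by (rule Lim_transform_eventually) (auto intro!: eventually_at_rightI[of 0 1] simp: eq)
qed

text \<open>The principal value multiplies the boundary term of sign \<sigma> by i pi \<sigma>, up
  to the sign in \<kappa>; this turns the difference in the jump into a sum.\<close>

lemma pv_integral_SF_jump:
  fixes f :: "real ^ 'n \<Rightarrow> complex"
  assumes g_eq: "g = (\<lambda>t. if t \<in> pos_orthant then f t else 0)"
    and g: "continuous_on UNIV g" "\<And>t. norm t > R \<Longrightarrow> g t = 0"
    and i: "\<And>\<sigma>. \<sigma> = 1 \<or> \<sigma> = -1 \<Longrightarrow> integrable (radial_measure (CARD('n) - 1)) (\<lambda>r. fourier g ((\<sigma> * r) *\<^sub>R p))"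
    and p: "norm p = 1" and R: "R \<ge> 0"
  shows "pv_integral a (\<lambda>\<xi>. SF_jump f p (- \<xi>) / complex_of_real (a - \<xi>)) =
    (-1) ^ CARD('n) * \<i> * (\<i> ^ CARD('n) * radial_fourier g 1 p (- a) + (- \<i>) ^ CARD('n) * radial_fourier g (-1) p (- a))"
proof -
  let ?M = "radial_measure (CARD('n) - 1)"
  \<comment> \<open>The exponent is d instead of d - 1: after the shift \<xi> = a + s the
    denominator is a - \<xi> = - s, and this sign is absorbed here.\<close>
  define \<kappa> where "\<kappa> = (-1) ^ CARD('n) / complex_of_real pi"
  define u where "u \<sigma> r = fourier g ((\<sigma> * r) *\<^sub>R p) * cis (\<sigma> * a * r)" for \<sigma> r :: real
  have "integrable lborel g"
    by (rule integrable_continuous_compact_support[OF g(1) compact_cball[of 0 R]]) (use g(2) in auto)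
  then have [measurable]: "g \<in> borel_measurable borel"
    using borel_measurable_integrable by fastforce
  have iu: "integrable ?M (u \<sigma>)" if "\<sigma> = 1 \<or> \<sigma> = -1" for \<sigma>
    unfolding u_def by (rule Bochner_Integration.integrable_bound[OF i[OF that]]) (auto simp: norm_mult)
  have rf: "radial_fourier g \<sigma> p (- (a + s)) = (LINT r|?M. u \<sigma> r * cis (\<sigma> * r * s))" for \<sigma> s
    unfolding radial_fourier_def u_def
    by (intro Bochner_Integration.integral_cong refl)
       (simp only: mult.assoc cis_mult, simp add: algebra_simps)
  have rf0: "radial_fourier g \<sigma> p (- a) = (LINT r|?M. u \<sigma> r)" for \<sigma>
    using rf[of \<sigma> 0] by simp
  define G where "G \<sigma> \<epsilon> = (LBINT s:{s. \<epsilon> < \<bar>s\<bar> \<and> \<bar>s\<bar> < 1 / \<epsilon>}. (LINT r|?M. u \<sigma> r * cis (\<sigma> * r * s)) / complex_of_real s)" for \<sigma> \<epsilon> :: real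
  have G: "(G \<sigma> \<longlongrightarrow> \<i> * complex_of_real pi * complex_of_real \<sigma> * radial_fourier g \<sigma> p (- a)) (at_right 0)"
    if "\<sigma> = 1 \<or> \<sigma> = -1" for \<sigma>
    unfolding G_def rf0 by (rule annulus_integral_tendsto(2)[OF iu[OF that] that])
  have lim: "((\<lambda>\<epsilon>. \<kappa> * (\<i> ^ CARD('n) * G 1 \<epsilon> - (- \<i>) ^ CARD('n) * G (-1) \<epsilon>)) \<longlongrightarrow>
    \<kappa> * (\<i> ^ CARD('n) * (\<i> * complex_of_real pi * complex_of_real 1 * radial_fourier g 1 p (- a)) -
      (- \<i>) ^ CARD('n) * (\<i> * complex_of_real pi * complex_of_real (-1) * radial_fourier g (-1) p (- a)))) (at_right 0)"
    by (intro tendsto_mult_left tendsto_diff G) auto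
  have jump: "SF_jump f p \<xi> = (-1) ^ (CARD('n) - 1) / complex_of_real pi *
    (\<i> ^ CARD('n) * radial_fourier g 1 p \<xi> - (- \<i>) ^ CARD('n) * radial_fourier g (-1) p \<xi>)" for \<xi>
    using SF_jump_eq_radial_fourier[OF g_eq g i] by blast
  have eq: "(LINT \<xi>:{\<xi>. \<epsilon> < \<bar>\<xi> - a\<bar>}|lborel. SF_jump f p (- \<xi>) / complex_of_real (a - \<xi>)) =
    \<kappa> * (\<i> ^ CARD('n) * G 1 \<epsilon> - (- \<i>) ^ CARD('n) * G (-1) \<epsilon>)"
    if \<epsilon>: "0 < \<epsilon>" "\<epsilon> < 1 / (R + \<bar>a\<bar> + 1)" for \<epsilon>
  proof -
    let ?A = "{s. \<epsilon> < \<bar>s\<bar> \<and> \<bar>s\<bar> < 1 / \<epsilon>}"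
    \<comment> \<open>Beyond the outer radius |a + s| then exceeds \<open>R\<close>, where the jump
      vanishes; the cutoff at 1 / \<epsilon> therefore changes nothing.\<close>
    have inv: "1 / \<epsilon> > R + \<bar>a\<bar>"
    proof -
      have "R + \<bar>a\<bar> + 1 > 0" using R by simp
      then have "R + \<bar>a\<bar> + 1 < 1 / \<epsilon>" using \<epsilon> by (simp add: field_simps)
      then show ?thesis by simp
    qed
    have J: "SF_jump f p (- (a + s)) / complex_of_real (- s) =
      \<kappa> * (\<i> ^ CARD('n) * ((LINT r|?M. u 1 r * cis (1 * r * s)) / complex_of_real s) -
        (- \<i>) ^ CARD('n) * ((LINT r|?M. u (-1) r * cis (-1 * r * s)) / complex_of_real s))" for s
    proof -
      have "(-1 :: complex) ^ CARD('n) = - ((-1) ^ (CARD('n) - 1))"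
        by (metis One_nat_def Suc_pred mult_minus1 power_Suc zero_less_card_finite)
      then show ?thesis
        unfolding jump rf \<kappa>_def
        by (cases "s = 0") (simp_all add: field_simps)
    qed
    let ?F = "\<lambda>\<xi>. indicator {\<xi>. \<epsilon> < \<bar>\<xi> - a\<bar>} \<xi> *\<^sub>R (SF_jump f p (- \<xi>) / complex_of_real (a - \<xi>))"
    have "(LINT \<xi>:{\<xi>. \<epsilon> < \<bar>\<xi> - a\<bar>}|lborel. SF_jump f p (- \<xi>) / complex_of_real (a - \<xi>)) =
      (LINT s:{s. \<epsilon> < \<bar>s\<bar>}|lborel. SF_jump f p (- (a + s)) / complex_of_real (- s))"
      unfolding set_lebesgue_integral_def lborel_integral_real_affine[OF one_neq_zero, of ?F a]
      by (simp add: indicator_def)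
    also have "\<dots> = (LINT s:?A|lborel. SF_jump f p (- (a + s)) / complex_of_real (- s))"
      unfolding set_lebesgue_integral_def
    proof (intro Bochner_Integration.integral_cong refl)
      fix s
      have "SF_jump f p (- (a + s)) = 0" if "\<bar>s\<bar> \<ge> 1 / \<epsilon>"
        by (rule SF_jump_eq_0[OF g_eq g]) (use that inv p R in auto)
      then show "indicator {s. \<epsilon> < \<bar>s\<bar>} s *\<^sub>R (SF_jump f p (- (a + s)) / complex_of_real (- s)) =
          indicator ?A s *\<^sub>R (SF_jump f p (- (a + s)) / complex_of_real (- s))"
        by (cases "\<bar>s\<bar> < 1 / \<epsilon>") (auto simp: indicator_def)
    qed
    also have "\<dots> = \<kappa> * (\<i> ^ CARD('n) * G 1 \<epsilon> - (- \<i>) ^ CARD('n) * G (-1) \<epsilon>)"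
    proof -
      have i1: "set_integrable lborel ?A (\<lambda>s. (LINT r|?M. u 1 r * cis (1 * r * s)) / complex_of_real s)"
        by (rule annulus_integral_tendsto(1)[OF iu _ \<epsilon>(1)]) simp_all
      have i2: "set_integrable lborel ?A (\<lambda>s. (LINT r|?M. u (-1) r * cis (-1 * r * s)) / complex_of_real s)"
        by (rule annulus_integral_tendsto(1)[OF iu _ \<epsilon>(1)]) simp_all
      show ?thesis
        unfolding J set_integral_mult_right
          set_integral_diff(2)[OF set_integrable_mult_right[OF i1] set_integrable_mult_right[OF i2]] G_def ..
    qed
    finally show ?thesis .
  qed
  have "pv_integral a (\<lambda>\<xi>. SF_jump f p (- \<xi>) / complex_of_real (a - \<xi>)) =
    \<kappa> * (\<i> ^ CARD('n) * (\<i> * complex_of_real pi * complex_of_real 1 * radial_fourier g 1 p (- a)) -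
      (- \<i>) ^ CARD('n) * (\<i> * complex_of_real pi * complex_of_real (-1) * radial_fourier g (-1) p (- a)))"
    unfolding pv_integral_def
  proof (rule tendsto_Lim[OF _ Lim_transform_eventually[OF lim]])
    show "\<forall>\<^sub>F \<epsilon> in at_right 0. \<kappa> * (\<i> ^ CARD('n) * G 1 \<epsilon> - (- \<i>) ^ CARD('n) * G (-1) \<epsilon>) =
      (LINT \<xi>:{\<xi>. \<epsilon> < \<bar>\<xi> - a\<bar>}|lborel. SF_jump f p (- \<xi>) / complex_of_real (a - \<xi>))"
      by (rule eventually_at_rightI[of 0 "1 / (R + \<bar>a\<bar> + 1)"]) (use eq R in auto)
  qed simp
  also have "\<dots> = (-1) ^ CARD('n) * \<i> * (\<i> ^ CARD('n) * radial_fourier g 1 p (- a) + (- \<i>) ^ CARD('n) * radial_fourier g (-1) p (- a))"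
    by (simp add: \<kappa>_def field_simps)
  finally show ?thesis .
qed

text \<open>\<open>h\<close> is known on unit vectors only, so it is replaced pointwise under the
  indicator of the sphere first; the indicator is then removed almost everywhere.\<close>

lemma set_integral_sphere_linear:
  fixes A B :: "real ^ 'n \<Rightarrow> complex"
  assumes "\<And>p. norm p = 1 \<Longrightarrow> h p = \<alpha> * A p + \<beta> * B p"
    and A: "integrable sphere_measure A" and B: "integrable sphere_measure B"
  shows "(LINT p:sphere 0 1|sphere_measure. h p) =
    \<alpha> * (LINT p|sphere_measure. A p) + \<beta> * (LINT p|sphere_measure. B p)"
proof -
  have [measurable]: "A \<in> borel_measurable borel" "B \<in> borel_measurable borel"
    using borel_measurable_integrable[OF A] borel_measurable_integrable[OF B]
    by (simp_all cong: measurable_cong_sets)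
  have "(LINT p:sphere 0 1|sphere_measure. h p) =
      (LINT p|sphere_measure. (if norm p = 1 then 1 else 0) *\<^sub>R (\<alpha> * A p + \<beta> * B p))"
    unfolding set_lebesgue_integral_def
    by (intro Bochner_Integration.integral_cong refl) (auto simp: assms(1) indicator_def)
  also have "\<dots> = (LINT p|sphere_measure. \<alpha> * A p + \<beta> * B p)"
  proof (rule integral_cong_AE)
    show "AE p in sphere_measure. (if norm p = 1 then 1 else 0) *\<^sub>R (\<alpha> * A p + \<beta> * B p) = \<alpha> * A p + \<beta> * B p"
      using AE_sphere_measure by eventually_elim simp
  qed measurable
  also have "\<dots> = \<alpha> * (LINT p|sphere_measure. A p) + \<beta> * (LINT p|sphere_measure. B p)"
    using A B by simp
  finally show ?thesis .
qed

lemma open_pos_orthant: "open (pos_orthant :: (real ^ 'n) set)"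
proof -
  have eq: "(pos_orthant :: (real ^ 'n) set) = (\<Inter>i\<in>UNIV. {x. 0 < x $ i})"
    by (auto simp: pos_orthant_def)
  show ?thesis unfolding eq
    by (intro open_INT ballI open_Collect_less continuous_intros) auto
qed

text \<open>The sphere integrals evaluate to 2 i (-1)^m (2 pi)^d f(x) for d = 2 m and to 2 i (-1)^m
  (2 pi)^d f(x) / pi for d = 2 m + 1. The 2 counts the two signs \<sigma>; the i comes from the
  principal value in the even case and from i^d in the odd case. The prefactors
  \<open>- 1 / (2 * \<i>)\<close> and \<open>1 / (2 * \<i>)\<close> compensate for the normalisation
  of the jump by 1 / pi.\<close>

theorem theorem4p2:
  fixes f :: "real ^ 'n \<Rightarrow> complex" and x :: "real ^ 'n"
  assumes "test_function f" and "x \<in> pos_orthant"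
  shows "(even CARD('n) \<longrightarrow>
      f x = (- 1 / (2 * \<i>)) * (- ((- 1) ^ (CARD('n) div 2)) / complex_of_real (2 * pi) ^ CARD('n)) *
        (LINT p:sphere 0 1|sphere_measure.
           pv_integral (p \<bullet> x) (\<lambda>\<xi>. SF_jump f p (- \<xi>) / complex_of_real (p \<bullet> x - \<xi>)))) \<and>
    (odd CARD('n) \<longrightarrow>
      f x = (1 / (2 * \<i>)) *
        ((- 1) ^ ((CARD('n) - 1) div 2) / (2 * complex_of_real (2 * pi) ^ (CARD('n) - 1))) *
        (LINT p:sphere 0 1|sphere_measure. SF_jump f p (- (p \<bullet> x))))"
proof -
  let ?d = "CARD('n)"
  let ?K = "closure {t \<in> pos_orthant. f t \<noteq> 0}"
  define g where "g = (\<lambda>t. if t \<in> pos_orthant then f t else 0)"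
  have gx: "g x = f x" using assms(2) by (simp add: g_def)
  have K: "compact ?K" "?K \<subseteq> pos_orthant" and Ck: "C_k_on k f pos_orthant" for k
    using assms(1) by (auto simp: test_function_def)
  have zero: "f t = 0" if "t \<in> pos_orthant - ?K" for t
    using that closure_subset[of "{t \<in> pos_orthant. f t \<noteq> 0}"] by auto
  obtain R0 where R0: "\<And>t. t \<in> ?K \<Longrightarrow> norm t \<le> R0"
    using compact_imp_bounded[OF K(1)] unfolding bounded_iff by blast
  \<comment> \<open>For empty support the bound \<open>R0\<close> is arbitrary and may be
    negative.\<close>
  define R where "R = max R0 0"
  have gR: "g t = 0" if "norm t > R" for t
    using R0[of t] zero[of t] that by (auto simp: R_def g_def)
  have R: "R \<ge> 0" by (simp add: R_def)
  have Cg: "C_k_on k g UNIV" for k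
    unfolding g_def by (rule C_k_on_extend_zero[OF open_pos_orthant compact_imp_closed[OF K(1)] K(2) Ck zero])
  have cont: "continuous_on UNIV g" using Cg[of 0] by simp
  have ig: "integrable lborel g"
    by (rule integrable_continuous_compact_support[OF cont compact_cball[of 0 R]]) (use gR in auto)
  then have meas: "g \<in> borel_measurable borel"
    using borel_measurable_integrable by fastforce
  \<comment> \<open>d + 1 is the least integer order whose decay is integrable against
    r^(d-1).\<close>
  obtain C where C: "norm (fourier g q) \<le> C / (1 + norm q ^ (?d + 1))" for q
    using fourier_C_k_decay[OF Cg Cg gR] by blast
  note irad = integrable_radial_fourier[OF meas C]
  have ifg: "integrable lborel (fourier g)" by (rule integrable_fourier[OF meas C])
  obtain B where B: "norm (g t) \<le> B" for t
  proof -
    have "bounded (g ` cball 0 R)"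
      by (intro compact_imp_bounded compact_continuous_image continuous_on_subset[OF cont] compact_cball) auto
    then obtain B where "\<forall>y\<in>g ` cball 0 R. norm y \<le> B"
      unfolding bounded_iff ..
    then have B: "norm (g t) \<le> B" if "t \<in> cball 0 R" for t
      using that by blast
    have "norm (g t) \<le> max B 0" for t
      using B[of t] gR[of t] by (cases "norm t \<le> R") auto
    then show ?thesis by (rule that)
  qed
  note sph = integral_sphere_radial_fourier[OF ig cont B ifg, of _ x, unfolded gx]
  \<comment> \<open>Rewrite rules that cancel the two copies of (-1)^m, one from the prefactor and
    one from the evaluated integral, together with i * i = -1.\<close>
  have sq: "(-1) ^ m * ((-1) ^ m * z) = z" for z :: complex and m
    by (simp only: mult.assoc[symmetric] power_mult_distrib[symmetric]) simp
  have ii: "\<i> * ((-1) ^ m * (\<i> * ((-1) ^ m * z))) = - z" for z and m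
  proof -
    have "\<i> * ((-1) ^ m * (\<i> * ((-1) ^ m * z))) = (\<i> * \<i>) * ((-1) ^ m * ((-1) ^ m * z))"
      by (simp only: mult_ac)
    then show ?thesis by (simp add: sq)
  qed
  have pi: "complex_of_real (2 * pi) \<noteq> 0" by simp
  show ?thesis
  proof (intro conjI impI)
    assume ev: "even ?d"
    then obtain m where m: "?d = 2 * m" by (auto elim: evenE)
    have i: "\<i> ^ ?d = (-1) ^ m" "(- \<i>) ^ ?d = (-1) ^ m" unfolding m power_mult by simp_all
    have "(LINT p:sphere 0 1|sphere_measure.
           pv_integral (p \<bullet> x) (\<lambda>\<xi>. SF_jump f p (- \<xi>) / complex_of_real (p \<bullet> x - \<xi>))) =
      \<i> * (-1) ^ m * (LINT p|sphere_measure. radial_fourier g 1 p (- (p \<bullet> x))) +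
      \<i> * (-1) ^ m * (LINT p|sphere_measure. radial_fourier g (-1) p (- (p \<bullet> x)))"
    proof (rule set_integral_sphere_linear)
      fix p :: "real ^ 'n" assume p: "norm p = 1"
      show "pv_integral (p \<bullet> x) (\<lambda>\<xi>. SF_jump f p (- \<xi>) / complex_of_real (p \<bullet> x - \<xi>)) =
        \<i> * (-1) ^ m * radial_fourier g 1 p (- (p \<bullet> x)) + \<i> * (-1) ^ m * radial_fourier g (-1) p (- (p \<bullet> x))"
      proof -
        have "pv_integral (p \<bullet> x) (\<lambda>\<xi>. SF_jump f p (- \<xi>) / complex_of_real (p \<bullet> x - \<xi>)) =
          (-1) ^ ?d * \<i> * (\<i> ^ ?d * radial_fourier g 1 p (- (p \<bullet> x)) + (- \<i>) ^ ?d * radial_fourier g (-1) p (- (p \<bullet> x)))"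
          using pv_integral_SF_jump[OF g_def cont gR irad[OF p] p R] by blast
        then show ?thesis using ev by (simp add: i algebra_simps)
      qed
    qed (rule sph; simp)+
    also have "\<dots> = 2 * \<i> * (-1) ^ m * (complex_of_real (2 * pi) ^ ?d * f x)"
      by (simp add: sph algebra_simps)
    finally have I: "(LINT p:sphere 0 1|sphere_measure.
           pv_integral (p \<bullet> x) (\<lambda>\<xi>. SF_jump f p (- \<xi>) / complex_of_real (p \<bullet> x - \<xi>))) =
        2 * \<i> * (-1) ^ m * (complex_of_real (2 * pi) ^ ?d * f x)" .
    have dm: "?d div 2 = m" using m by simp
    show "f x = (- 1 / (2 * \<i>)) * (- ((- 1) ^ (?d div 2)) / complex_of_real (2 * pi) ^ ?d) *
        (LINT p:sphere 0 1|sphere_measure.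
           pv_integral (p \<bullet> x) (\<lambda>\<xi>. SF_jump f p (- \<xi>) / complex_of_real (p \<bullet> x - \<xi>)))"
      unfolding I dm using pi by (simp add: sq ii divide_simps)
  next
    assume odd: "odd ?d"
    then obtain m where m: "?d = 2 * m + 1" by (auto elim: oddE)
    have i: "\<i> ^ ?d = \<i> * (-1) ^ m" "(- \<i>) ^ ?d = - (\<i> * (-1) ^ m)"
      unfolding m power_add power_mult by simp_all
    let ?c = "\<i> * (-1) ^ m / complex_of_real pi"
    have "(LINT p:sphere 0 1|sphere_measure. SF_jump f p (- (p \<bullet> x))) =
      ?c * (LINT p|sphere_measure. radial_fourier g 1 p (- (p \<bullet> x))) +
      ?c * (LINT p|sphere_measure. radial_fourier g (-1) p (- (p \<bullet> x)))"
    proof (rule set_integral_sphere_linear)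
      fix p :: "real ^ 'n" assume p: "norm p = 1"
      show "SF_jump f p (- (p \<bullet> x)) =
        ?c * radial_fourier g 1 p (- (p \<bullet> x)) + ?c * radial_fourier g (-1) p (- (p \<bullet> x))"
      proof -
        have "SF_jump f p (- (p \<bullet> x)) = (-1) ^ (?d - 1) / complex_of_real pi *
          (\<i> ^ ?d * radial_fourier g 1 p (- (p \<bullet> x)) - (- \<i>) ^ ?d * radial_fourier g (-1) p (- (p \<bullet> x)))"
          using SF_jump_eq_radial_fourier[OF g_def cont gR irad[OF p]] by blast
        moreover have "(-1 :: complex) ^ (?d - 1) = 1" using m by simp
        ultimately show ?thesis by (simp add: i field_simps)
      qed
    qed (rule sph; simp)+
    also have "\<dots> = 2 * ?c * (complex_of_real (2 * pi) ^ ?d * f x)"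
      by (simp add: sph algebra_simps)
    finally have I: "(LINT p:sphere 0 1|sphere_measure. SF_jump f p (- (p \<bullet> x))) =
        2 * ?c * (complex_of_real (2 * pi) ^ ?d * f x)" .
    have dm: "(?d - 1) div 2 = m" and d2: "complex_of_real (2 * pi) ^ ?d = complex_of_real (2 * pi) * complex_of_real (2 * pi) ^ (?d - 1)"
      using m by simp_all
    show "f x = (1 / (2 * \<i>)) *
        ((- 1) ^ ((?d - 1) div 2) / (2 * complex_of_real (2 * pi) ^ (?d - 1))) *
        (LINT p:sphere 0 1|sphere_measure. SF_jump f p (- (p \<bullet> x)))"
      unfolding I dm d2 using pi by (simp add: sq ii divide_simps)
  qed
qed

end
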